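(* Let $n\ge1$. If $\mu$ is a $(2n+1)$-uniform measure on $\mathbb{H}^n$ for which there exists $\mathfrak{n}\in\mathbb{S}^{2n-1}$ such that $\mathcal{C}^{2n+1}\llcorner V(\mathfrak{n})\in\mathrm{Tan}_{2n+1}(\mu,\infty)$, then $\mu=\mathcal{C}^{2n+1}\llcorner V(\mathfrak{n})$.
   Context: The Heisenberg group $\mathbb{H}^n$ is $\mathbb{R}^{2n}\times\mathbb{R}$, with points $x=(x_H,x_T)$ and product $x*y=(x_H+y_H,\,x_T+y_T+2\langle x_H,Jy_H\rangle)$, where $J=\begin{pmatrix}0&\mathrm{id}_n\\-\mathrm{id}_n&0\end{pmatrix}$. The Koranyi norm is $\|x\|=(|x_H|^4+|x_T|^2)^{1/4}$, the Koranyi distance is $d(x,y)=\|x^{-1}*y\|$, $B_r(x)=\{z: d(z,x)\le r\}$, and $D_\lambda(x)=(\lambda x_H,\lambda^2x_T)$ for $\lambda>0$. $\mathbb{S}^{2n-1}$ is the Euclidean unit sphere of $\mathbb{R}^{2n}$. A Radon measure $\mu$ is $m$-uniform if $0\in\mathrm{supp}(\mu)$ and $\mu(B_r(x))=r^m$ for all $r>0$ and $x\in\mathrm{supp}(\mu)$. Let $\mu_{0,R}(A)=\mu(D_R(A))$. $\mathrm{Tan}_{m}(\mu,\infty)$ is the set of Radon measures $\nu$ for which there is a sequence $R_i\to\infty$ with $R_i^{-m}\mu_{0,R_i}\rightharpoonup\nu$ (convergence tested against continuous compactly supported functions). $V(\mathfrak{n})=\{z\in\mathbb{H}^n:\langle\mathfrak{n},z_H\rangle=0\}$.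 $\mathcal{C}^{m}$ is the centered spherical Hausdorff measure: $\mathcal{C}^{m}(A)=\sup_{E\subseteq A}\mathcal{C}^m_0(E)$, with $\mathcal{C}_0^m(E)=\sup_{\delta>0}\inf\{\sum_jr_j^m: E\subseteq\bigcup_jB_{r_j}(x_j),\ x_j\in E,\ r_j\le\delta\}$. (The measure $\mathcal{C}^{2n+1}\llcorner V(\mathfrak{n})$ is the Haar measure of $V(\mathfrak{n})$ giving mass $1$ to $B_1(0)$.) *)

theory Defs
  imports "HOL-Analysis.Analysis"
begin

text \<open>
  The Heisenberg group of dimension \<open>2n + 1\<close>, \<open>n = CARD('n)\<close>, in the coordinates
  \<open>((p, q), t)\<close>: the horizontal part is \<open>(p, q)\<close>, the vertical part is \<open>t\<close>.
  Open, compact, continuous and Borel refer to the Euclidean product topology, which is also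
  the one induced by the Koranyi distance.
\<close>

type_synonym 'n hvec = "(real ^ 'n) \<times> (real ^ 'n)"
type_synonym 'n heis = "'n hvec \<times> real"

definition sympJ :: "'n::finite hvec \<Rightarrow> 'n hvec" where
  "sympJ v = (snd v, - fst v)"

definition hmult :: "'n::finite heis \<Rightarrow> 'n heis \<Rightarrow> 'n heis" (infixl "\<star>" 70) where
  "x \<star> y = (fst x + fst y, snd x + snd y + 2 * (fst x \<bullet> sympJ (fst y)))"

definition hinv :: "'n::finite heis \<Rightarrow> 'n heis" where
  "hinv x = (- fst x, - snd x)"

lemma hinv_left: "hinv x \<star> x = 0" and hinv_right: "x \<star> hinv x = 0"
  by (simp_all add: hinv_def hmult_def sympJ_def prod_eq_iff inner_prod_def inner_commute)

definition koranyi_norm :: "'n::finite heis \<Rightarrow> real" where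
  "koranyi_norm x = root 4 (norm (fst x) ^ 4 + \<bar>snd x\<bar> ^ 2)"

definition koranyi_dist :: "'n::finite heis \<Rightarrow> 'n heis \<Rightarrow> real" where
  "koranyi_dist x y = koranyi_norm (hinv x \<star> y)"

definition kball :: "'n::finite heis \<Rightarrow> real \<Rightarrow> 'n heis set" where
  "kball x r = {z. koranyi_dist x z \<le> r}"

definition dilation :: "real \<Rightarrow> 'n::finite heis \<Rightarrow> 'n heis" where
  "dilation l x = (l *\<^sub>R fst x, l\<^sup>2 * snd x)"

definition vplane :: "'n::finite hvec \<Rightarrow> 'n heis set" where
  "vplane \<nn> = {z. \<nn> \<bullet> fst z = 0}"

definition radon_measure :: "'a::topological_space measure \<Rightarrow> bool" where
  "radon_measure M \<longleftrightarrow>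
     sets M = sets borel \<and>
     (\<forall>K. compact K \<longrightarrow> emeasure M K < \<infinity>) \<and>
     (\<forall>A \<in> sets borel. emeasure M A = (SUP K \<in> {K. compact K \<and> K \<subseteq> A}. emeasure M K))"

definition msupport :: "'a::topological_space measure \<Rightarrow> 'a set" where
  "msupport M = {x. \<forall>U. open U \<and> x \<in> U \<longrightarrow> emeasure M U > 0}"

definition uniform_measure_dim :: "nat \<Rightarrow> 'n::finite heis measure \<Rightarrow> bool" where
  "uniform_measure_dim m \<mu> \<longleftrightarrow>
     radon_measure \<mu> \<and> 0 \<in> msupport \<mu> \<and>
     (\<forall>x \<in> msupport \<mu>. \<forall>r > 0. emeasure \<mu> (kball x r) = ennreal (r ^ m))"

text \<open>
  \<open>rescale \<mu> R\<close> is the measure \<open>A \<mapsto> \<mu> (D\<^sub>R A)\<close>, written as the image of \<open>\<mu>\<close> under the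
  inverse dilation; see \<open>emeasure_rescale\<close>.
\<close>

definition rescale :: "'n::finite heis measure \<Rightarrow> real \<Rightarrow> 'n heis measure" where
  "rescale \<mu> R = distr \<mu> borel (dilation (1 / R))"

lemma emeasure_rescale:
  fixes \<mu> :: "'n::finite heis measure"
  assumes "sets \<mu> = sets borel" "R > 0" "A \<in> sets borel"
  shows "emeasure (rescale \<mu> R) A = emeasure \<mu> (dilation R ` A)"
proof -
  have inv1: "dilation (1 / R) (dilation R x) = x" "dilation R (dilation (1 / R) x) = x"
    for x :: "'n heis"
    using assms(2) by (simp_all add: dilation_def prod_eq_iff power2_eq_square)
  have "(dilation (1 / R) :: 'n heis \<Rightarrow> _) \<in> borel_measurable borel"
    unfolding dilation_def by (intro borel_measurable_continuous_onI continuous_intros)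
  then have meas: "dilation (1 / R) \<in> measurable \<mu> borel"
    using measurable_cong_sets[OF assms(1) refl] by blast
  have "space \<mu> = UNIV"
    using sets_eq_imp_space_eq[OF assms(1)] by simp
  moreover have "dilation (1 / R) -` A = dilation R ` A"
    using inv1 by (auto simp: image_iff) metis
  ultimately show ?thesis
    unfolding rescale_def by (simp add: emeasure_distr[OF meas assms(3)])
qed

definition vague_limit ::
    "(nat \<Rightarrow> 'a::topological_space measure) \<Rightarrow> 'a measure \<Rightarrow> bool" where
  "vague_limit M N \<longleftrightarrow>
     (\<forall>f :: 'a \<Rightarrow> real. continuous_on UNIV f \<and> compact (closure {x. f x \<noteq> 0}) \<longrightarrow>
        (\<lambda>i. integral\<^sup>L (M i) f) \<longlonglongrightarrow> integral\<^sup>L N f)"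

definition Tan_infinity :: "nat \<Rightarrow> 'n::finite heis measure \<Rightarrow> 'n heis measure set" where
  "Tan_infinity m \<mu> = {\<nu>. radon_measure \<nu> \<and>
     (\<exists>R :: nat \<Rightarrow> real. (\<forall>i. R i > 0) \<and> filterlim R at_top sequentially \<and>
        vague_limit (\<lambda>i. scale_measure (ennreal (1 / R i ^ m)) (rescale \<mu> (R i))) \<nu>)}"

text \<open>
  Covers are indexed by a set \<open>I\<close> of natural numbers, so that finite covers (in particular the
  empty cover of the empty set, which admits no centre) are included.
\<close>

definition centered_spherical0 :: "nat \<Rightarrow> 'n::finite heis set \<Rightarrow> ennreal" where
  "centered_spherical0 m E =
     (SUP \<delta> \<in> {0 :: real <..}.
        Inf {(\<Sum>j. if j \<in> I then ennreal (r j ^ m) else 0) |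
               (I :: nat set) (x :: nat \<Rightarrow> 'n heis) (r :: nat \<Rightarrow> real).
               E \<subseteq> (\<Union>j \<in> I. kball (x j) (r j)) \<and>
               (\<forall>j \<in> I. x j \<in> E \<and> 0 < r j \<and> r j \<le> \<delta>)})"

definition centered_spherical :: "nat \<Rightarrow> 'n::finite heis set \<Rightarrow> ennreal" where
  "centered_spherical m A = (SUP E \<in> Pow A. centered_spherical0 m E)"

text \<open>
  \<open>centered_spherical m\<close> is a metric outer measure, so its restriction to \<open>S\<close> is countably
  additive on the Borel sets and \<open>measure_of\<close> takes the value
  \<open>centered_spherical m (A \<inter> S)\<close> on each Borel set \<open>A\<close>.
\<close>

definition centered_spherical_on :: "nat \<Rightarrow> 'n::finite heis set \<Rightarrow> 'n heis measure" where
  "centered_spherical_on m S =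
     measure_of UNIV (sets borel) (\<lambda>A. centered_spherical m (A \<inter> S))"

end

theory Submission imports Defs begin

text \<open>
  Let \<open>S\<close> be the support of \<open>\<mu>\<close>, \<open>V = vplane \<nn>\<close>, and \<open>\<nu>\<close> the flat measure on \<open>V\<close>.

  \<^emph>\<open>The flat measure.\<close>  Vague convergence of the blow-downs gives \<open>\<nu> (kball 0 r) = r ^ m\<close>, and \<open>\<nu>\<close> is
  invariant under left translations by elements of \<open>V\<close>.  So \<open>\<nu>\<close> is itself an \<open>m\<close>-uniform measure, with
  support \<open>V\<close> (\<open>flat_measure_uniform\<close>).

  \<^emph>\<open>The support lies in two parallel planes.\<close>  For a uniform measure, the integral of a radial function
  around \<open>x \<in> S\<close> equals the integral of the same radial function around \<open>0\<close>.  For the blow-down by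
  \<open>R\<close> the point \<open>x\<close> moves to \<open>dilation (1 / R) x\<close>, and the equality can be expanded in powers of \<open>1 / R\<close>
  (\<open>tendsto_second_order\<close>).  The term of order one is linear in the horizontal part \<open>x\<^sub>H\<close>; the
  coefficient of the term of order two converges to the corresponding coefficient of \<open>\<nu>\<close>, which is
  \<open>- k (\<nn> \<bullet> x\<^sub>H)\<^sup>2\<close> with \<open>k > 0\<close> (\<open>integral_second_order_flat\<close>).  In the limit there is a linear
  functional \<open>g\<close> with \<open>g x\<^sub>H = k (\<nn> \<bullet> x\<^sub>H)\<^sup>2\<close> for all \<open>x \<in> S\<close> (\<open>limit_functional\<close>).  In particular
  \<open>g \<ge> 0\<close> on \<open>S\<close>.  This half-space condition survives the blow-down, so \<open>g \<ge> 0\<close> on the hyperplane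
  orthogonal to \<open>\<nn>\<close>, where \<open>g\<close> must then vanish.  Hence \<open>g\<close> is a multiple of \<open>\<nn> \<bullet> _\<close>, and \<open>\<nn> \<bullet> x\<^sub>H\<close>
  takes at most two values on \<open>S\<close>, one of which is \<open>0\<close> (\<open>blowdown_flat_support\<close>).

  \<^emph>\<open>Conclusion.\<close>  A Fubini argument shows that \<open>\<mu>\<close> is the restriction of \<open>\<nu>\<close> to \<open>S\<close> wherever \<open>S\<close> stays
  inside \<open>V\<close> (\<open>uniform_measure_eq_restricted\<close>).  Uniformity makes \<open>S \<inter> V\<close> relatively open in the
  connected set \<open>V\<close>, so \<open>V \<subseteq> S\<close>.  Then \<open>V\<close> carries the whole \<open>\<mu>\<close>-mass of every ball around \<open>0\<close>, so
  \<open>S = V\<close> and \<open>\<mu> = \<nu>\<close> (\<open>uniform_measure_eq_flat\<close>).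
\<close>

section \<open>Koranyi geometry of the Heisenberg group\<close>

lemma sympJ_linear [simp]:
  "sympJ (u + v) = sympJ u + sympJ v" "sympJ (u - v) = sympJ u - sympJ v"
  "sympJ (c *\<^sub>R u) = c *\<^sub>R sympJ u" "sympJ (- u) = - sympJ u" "sympJ 0 = 0"
  by (auto simp: sympJ_def prod_eq_iff)

lemma
  fixes u v :: "'n::finite hvec"
  shows inner_sympJ_swap: "u \<bullet> sympJ v = - (v \<bullet> sympJ u)"
    and inner_sympJ_self [simp]: "u \<bullet> sympJ u = 0"
    and norm_sympJ [simp]: "norm (sympJ u) = norm u"
proof -
  show "u \<bullet> sympJ v = - (v \<bullet> sympJ u)" for v
    by (simp add: sympJ_def inner_prod_def inner_commute)
  then show "u \<bullet> sympJ u = 0" by (metis equal_neg_zero)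
  show "norm (sympJ u) = norm u"
    by (simp add: sympJ_def norm_prod_def add.commute)
qed

lemma continuous_on_sympJ [continuous_intros]:
  "continuous_on S f \<Longrightarrow> continuous_on S (\<lambda>x. sympJ (f x))"
  unfolding sympJ_def by (intro continuous_intros)

definition kor4 :: "'n::finite heis \<Rightarrow> real" where
  "kor4 z = norm (fst z) ^ 4 + (snd z)\<^sup>2"

lemma kor4_nonneg [simp]: "0 \<le> kor4 z"
  by (simp add: kor4_def)

lemma koranyi_norm_kor4: "koranyi_norm z = root 4 (kor4 z)"
  by (simp add: koranyi_norm_def kor4_def)

lemma koranyi_norm_nonneg [simp]: "0 \<le> koranyi_norm z"
  by (simp add: koranyi_norm_kor4)

lemma koranyi_norm_pow4: "koranyi_norm z ^ 4 = kor4 z"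
  by (simp add: koranyi_norm_kor4)

lemma koranyi_norm_le_iff: "0 \<le> r \<Longrightarrow> koranyi_norm z \<le> r \<longleftrightarrow> kor4 z \<le> r ^ 4"
  by (metis koranyi_norm_nonneg koranyi_norm_pow4 power_mono_iff zero_less_numeral)

lemma koranyi_dist_nonneg [simp]: "0 \<le> koranyi_dist x y"
  by (simp add: koranyi_dist_def)

lemma hinv_hmult:
  "hinv x \<star> y = (fst y - fst x, snd y - snd x - 2 * (fst x \<bullet> sympJ (fst y)))"
  by (simp add: hmult_def hinv_def)

lemma hmult_assoc: "x \<star> y \<star> z = x \<star> (y \<star> z)"
  by (simp add: hmult_def algebra_simps)

lemma hmult_zero [simp]: "0 \<star> x = x" "x \<star> 0 = x"
  by (simp_all add: hmult_def)

lemma koranyi_norm_hinv [simp]: "koranyi_norm (hinv x) = koranyi_norm x"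
  by (simp add: hinv_def koranyi_norm_def)

lemma hinv_hmult_rev: "hinv (x \<star> y) = hinv y \<star> hinv x"
  using inner_sympJ_swap[of "fst x" "fst y"] by (simp add: hinv_def hmult_def)

lemma hinv_hinv [simp]: "hinv (hinv x) = x"
  by (simp add: hinv_def)

lemma hmult_hinv_cancel [simp]: "hinv x \<star> (x \<star> y) = y" "x \<star> (hinv x \<star> y) = y"
  by (simp_all add: hmult_assoc[symmetric] hinv_left hinv_right)

lemma koranyi_dist_commute: "koranyi_dist x y = koranyi_dist y x"
  unfolding koranyi_dist_def
  by (metis koranyi_norm_hinv hinv_hmult_rev hinv_hinv)

lemma koranyi_dist_left_invariant [simp]: "koranyi_dist (v \<star> x) (v \<star> y) = koranyi_dist x y"
  unfolding koranyi_dist_def by (simp add: hinv_hmult_rev hmult_assoc)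

lemma koranyi_dist_self [simp]: "koranyi_dist x x = 0"
  by (simp add: koranyi_dist_def hinv_left koranyi_norm_kor4 kor4_def)

lemma koranyi_dist_0 [simp]: "koranyi_dist 0 z = koranyi_norm z"
  by (simp add: koranyi_dist_def hinv_def hmult_def)

text \<open>
  Under \<open>z \<mapsto> (|z\<^sub>H|\<^sup>2, z\<^sub>T)\<close>, read as a complex number, the squared Koranyi norm is the modulus,
  and a product differs from the sum of the factors by twice the Hermitian product of the
  horizontal parts.  The modulus of the latter obeys Cauchy--Schwarz, which is Bessel's inequality
  for the orthogonal vectors \<open>v\<close> and \<open>J v\<close>.
\<close>

lemma hermitian_cauchy_schwarz:
  fixes u v :: "'n::finite hvec"
  shows "(u \<bullet> v)\<^sup>2 + (u \<bullet> sympJ v)\<^sup>2 \<le> (norm u * norm v)\<^sup>2"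
proof -
  let ?c = "u \<bullet> v" and ?d = "u \<bullet> sympJ v"
  let ?w = "?c *\<^sub>R v + ?d *\<^sub>R sympJ v"
  have JJ: "sympJ v \<bullet> sympJ v = v \<bullet> v" "sympJ v \<bullet> v = 0" "v \<bullet> sympJ v = 0"
    using inner_sympJ_self[of v] by (simp_all add: inner_commute) (simp add: sympJ_def inner_prod_def)
  have uw: "u \<bullet> ?w = ?c\<^sup>2 + ?d\<^sup>2"
    by (simp add: inner_add_right power2_eq_square)
  have "?w \<bullet> ?w = (?c\<^sup>2 + ?d\<^sup>2) * (v \<bullet> v)"
    by (simp add: inner_add_left inner_add_right JJ algebra_simps power2_eq_square)
  then have ww: "(norm ?w)\<^sup>2 = (?c\<^sup>2 + ?d\<^sup>2) * (norm v)\<^sup>2"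
    by (simp add: power2_norm_eq_inner)
  have "(u \<bullet> ?w)\<^sup>2 \<le> (norm u)\<^sup>2 * (norm ?w)\<^sup>2"
    using Cauchy_Schwarz_ineq[of u ?w] by (simp add: power2_norm_eq_inner)
  then have "(?c\<^sup>2 + ?d\<^sup>2) * (?c\<^sup>2 + ?d\<^sup>2) \<le> (norm u * norm v)\<^sup>2 * (?c\<^sup>2 + ?d\<^sup>2)"
    unfolding uw ww by (simp add: power2_eq_square algebra_simps)
  then show ?thesis
    by (cases "0 < ?c\<^sup>2 + ?d\<^sup>2") (simp_all add: mult_le_cancel_right_pos order_trans[of _ 0])
qed

lemma koranyi_norm_triangle:
  fixes x y :: "'n::finite heis"
  shows "koranyi_norm (x \<star> y) \<le> koranyi_norm x + koranyi_norm y"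
proof -
  define c where "c z = Complex ((norm (fst z))\<^sup>2) (snd z)" for z :: "'n heis"
  have c_norm: "norm (c z) = (koranyi_norm z)\<^sup>2" for z
  proof -
    have "(norm (c z))\<^sup>2 = ((koranyi_norm z)\<^sup>2)\<^sup>2"
      using koranyi_norm_pow4[of z] by (simp add: c_def cmod_power2 kor4_def)
    then show ?thesis by (rule power2_eq_imp_eq) simp_all
  qed
  let ?e = "Complex (fst x \<bullet> fst y) (fst x \<bullet> sympJ (fst y))"
  have "norm ?e \<le> norm (fst x) * norm (fst y)"
    using hermitian_cauchy_schwarz[of "fst x" "fst y"]
    by (simp add: cmod_def real_le_lsqrt)
  also have "norm (fst z) \<le> koranyi_norm z" for z :: "'n heis"
    by (rule power_le_imp_le_base[of _ 3]) (simp_all add: koranyi_norm_pow4 kor4_def)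
  then have "norm (fst x) * norm (fst y) \<le> koranyi_norm x * koranyi_norm y"
    by (intro mult_mono) auto
  finally have e: "norm ?e \<le> koranyi_norm x * koranyi_norm y" .
  have "c (x \<star> y) = c x + c y + 2 * ?e"
    by (simp add: c_def hmult_def complex_eq_iff power2_norm_eq_inner inner_add_left
        inner_add_right inner_commute)
  then have "norm (c (x \<star> y)) \<le> norm (c x) + norm (c y) + 2 * norm ?e"
    using norm_triangle_ineq[of "c x + c y" "2 * ?e"] norm_triangle_ineq[of "c x" "c y"]
    by (simp add: norm_mult)
  then have "(koranyi_norm (x \<star> y))\<^sup>2 \<le> (koranyi_norm x + koranyi_norm y)\<^sup>2"
    using e by (simp add: c_norm power2_sum)
  then show ?thesis
    by (rule power2_le_imp_le) simp
qed

lemma koranyi_dist_triangle: "koranyi_dist x z \<le> koranyi_dist x y + koranyi_dist y z"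
  using koranyi_norm_triangle[of "hinv x \<star> y" "hinv y \<star> z"]
  by (simp add: koranyi_dist_def hmult_assoc)

lemma dilation_hmult: "dilation l (x \<star> y) = dilation l x \<star> dilation l y"
  by (simp add: dilation_def hmult_def algebra_simps power2_eq_square)

lemma dilation_hinv: "dilation l (hinv x) = hinv (dilation l x)"
  by (simp add: dilation_def hinv_def)

lemma koranyi_norm_dilation: 
  assumes "0 \<le> l" shows "koranyi_norm (dilation l x) = l * koranyi_norm x"
proof -
  have "koranyi_norm (dilation l x) ^ 4 = (l * koranyi_norm x) ^ 4"
    by (simp add: koranyi_norm_pow4 kor4_def dilation_def power_mult_distrib algebra_simps
        flip: power_mult)
  then show ?thesis using assms by (simp add: power_eq_iff_eq_base)
qed

lemma koranyi_dist_dilation: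
  "0 \<le> l \<Longrightarrow> koranyi_dist (dilation l x) (dilation l y) = l * koranyi_dist x y"
  by (simp add: koranyi_dist_def koranyi_norm_dilation flip: dilation_hinv dilation_hmult)

lemma dilation_inverse [simp]:
  "0 < l \<Longrightarrow> dilation (1 / l) (dilation l x) = x" "0 < l \<Longrightarrow> dilation l (dilation (1 / l) x) = x"
  by (simp_all add: dilation_def prod_eq_iff power2_eq_square)

lemma dilation_kball:
  fixes x :: "'n::finite heis"
  assumes "0 < R"
  shows "dilation R ` kball (dilation (1 / R) x) r = kball x (R * r)"
proof -
  have *: "dilation R z \<in> kball x (R * r) \<longleftrightarrow> z \<in> kball (dilation (1 / R) x) r" for z
    using koranyi_dist_dilation[of R "dilation (1 / R) x" z] assms by (simp add: kball_def)
  show ?thesis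
  proof
    show "kball x (R * r) \<subseteq> dilation R ` kball (dilation (1 / R) x) r"
    proof
      fix z assume "z \<in> kball x (R * r)"
      then have "dilation R (dilation (1 / R) z) \<in> kball x (R * r)" using assms by simp
      then show "z \<in> dilation R ` kball (dilation (1 / R) x) r"
        using * assms by (metis dilation_inverse(2) imageI)
    qed
  qed (use * in auto)
qed

lemma continuous_on_hmult [continuous_intros]:
  "continuous_on S f \<Longrightarrow> continuous_on S g \<Longrightarrow> continuous_on S (\<lambda>x. f x \<star> g x)"
  unfolding hmult_def by (intro continuous_intros)

lemma continuous_on_koranyi_norm [continuous_intros]:
  "continuous_on S f \<Longrightarrow> continuous_on S (\<lambda>x. koranyi_norm (f x))"
  unfolding koranyi_norm_def by (intro continuous_intros)

lemma continuous_on_kor4 [continuous_intros]: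
  "continuous_on S f \<Longrightarrow> continuous_on S (\<lambda>x. kor4 (f x))"
  unfolding kor4_def by (intro continuous_intros)

lemma continuous_on_koranyi_dist [continuous_intros]:
  "continuous_on S f \<Longrightarrow> continuous_on S g \<Longrightarrow> continuous_on S (\<lambda>x. koranyi_dist (f x) (g x))"
  unfolding koranyi_dist_def hinv_def by (intro continuous_intros)

lemma closed_kball [simp]: "closed (kball x r)"
  unfolding kball_def by (intro closed_Collect_le continuous_intros)

lemma open_koranyi_ball: "open {z. koranyi_dist x z < r}"
  by (intro open_Collect_less continuous_intros)

lemma kball_in_borel [measurable]: "kball x r \<in> sets borel"
  by (intro borel_closed closed_kball)

text \<open>Small Koranyi balls are small in the Euclidean metric, and all of them are bounded.\<close>

lemma kball_subset_cball:
  fixes x :: "'n::finite heis"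
  assumes "0 \<le> r"
  shows "kball x r \<subseteq> cball x (r + (r\<^sup>2 + 2 * (norm (fst x) * r)))"
proof
  fix z assume "z \<in> kball x r"
  then have "kor4 (hinv x \<star> z) \<le> r ^ 4"
    using assms by (simp add: kball_def koranyi_dist_def koranyi_norm_le_iff)
  then have k: "norm (fst z - fst x) ^ 4 + (snd z - snd x - 2 * (fst x \<bullet> sympJ (fst z)))\<^sup>2 \<le> r ^ 4"
    by (simp add: kor4_def hinv_hmult)
  have "norm (fst z - fst x) ^ 4 \<le> r ^ 4"
    by (rule order_trans[OF _ k]) simp
  then have h: "norm (fst z - fst x) \<le> r"
    using assms by simp
  have "(snd z - snd x - 2 * (fst x \<bullet> sympJ (fst z)))\<^sup>2 \<le> (r\<^sup>2)\<^sup>2"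
    by (rule order_trans[OF _ order_trans[OF k]]) simp_all
  then have t: "\<bar>snd z - snd x - 2 * (fst x \<bullet> sympJ (fst z))\<bar> \<le> r\<^sup>2"
    by (metis abs_le_square_iff abs_power2)
  have "fst x \<bullet> sympJ (fst z) = fst x \<bullet> sympJ (fst z - fst x)"
    by (simp add: inner_diff_right)
  also have "\<bar>\<dots>\<bar> \<le> norm (fst x) * norm (fst z - fst x)"
    by (metis Cauchy_Schwarz_ineq2 norm_sympJ)
  also have "\<dots> \<le> norm (fst x) * r"
    using h by (intro mult_left_mono) auto
  finally have "\<bar>snd z - snd x\<bar> \<le> r\<^sup>2 + 2 * (norm (fst x) * r)"
    using t by linarith
  moreover have "norm (z - x) \<le> norm (fst z - fst x) + \<bar>snd z - snd x\<bar>"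
    using norm_Pair_le[of "fst z - fst x" "snd z - snd x"] by (simp add: minus_prod_def)
  ultimately show "z \<in> cball x (r + (r\<^sup>2 + 2 * (norm (fst x) * r)))"
    using h by (simp add: dist_norm norm_minus_commute[of x z])
qed

lemma compact_kball [simp]:
  fixes x :: "'n::finite heis"
  shows "compact (kball x r)"
proof (cases "0 \<le> r")
  case True
  then show ?thesis
    using kball_subset_cball[OF True, of x] bounded_subset[OF bounded_cball]
    by (auto simp: compact_eq_bounded_closed)
next
  case False
  then have "kball x r = {}"
    by (auto simp: kball_def) (meson koranyi_dist_nonneg order_trans)
  then show ?thesis by simp
qed

lemma eventually_kball_subset:
  fixes x :: "'n::finite heis"
  assumes "open U" "x \<in> U"
  shows "\<forall>\<^sub>F r in at_right 0. kball x r \<subseteq> U"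
proof -
  obtain e where e: "e > 0" "ball x e \<subseteq> U"
    using assms by (meson open_contains_ball)
  have "((\<lambda>r. r + (r\<^sup>2 + 2 * (norm (fst x) * r))) \<longlongrightarrow> 0 + (0\<^sup>2 + 2 * (norm (fst x) * 0))) (at_right 0)"
    by (intro tendsto_intros)
  then have "\<forall>\<^sub>F r in at_right 0. r + (r\<^sup>2 + 2 * (norm (fst x) * r)) < e"
    using e(1) by (simp add: order_tendstoD)
  moreover have "\<forall>\<^sub>F r in at_right 0. (0::real) < r"
    by (simp add: eventually_at_right_less)
  ultimately show ?thesis
  proof eventually_elim
    case (elim r)
    then show ?case
      using kball_subset_cball[of r x] e(2) by (force simp: subset_iff)
  qed
qed

section \<open>Supports of locally finite measures\<close>

lemma open_compl_msupport: "open (- msupport M)"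
proof -
  have "- msupport M = \<Union>{U. open U \<and> emeasure M U = 0}"
    by (auto simp: msupport_def)
  then show ?thesis by auto
qed

lemma closed_msupport: "closed (msupport M)"
  using open_compl_msupport[of M] by (simp add: closed_open)

lemma msupport_borel [measurable]: "msupport M \<in> sets borel"
  by (intro borel_closed closed_msupport)

lemma emeasure_compl_msupport:
  fixes M :: "'a::second_countable_topology measure"
  assumes "sets M = sets borel"
  shows "emeasure M (- msupport M) = 0"
proof -
  let ?F = "{U. open U \<and> emeasure M U = 0}"
  obtain F' where F': "F' \<subseteq> ?F" "countable F'" "\<Union>F' = \<Union>?F"
    by (rule Lindelof[of ?F]) auto
  have "(\<Union>U \<in> F'. U) \<in> null_sets M"
    using F'(1,2) assms by (intro null_sets_UN') (auto simp: null_sets_def)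
  moreover have "- msupport M = \<Union>?F"
    by (auto simp: msupport_def)
  ultimately show ?thesis
    using F'(3) by (simp add: null_sets_def)
qed

lemma AE_msupport:
  fixes M :: "'a::second_countable_topology measure"
  assumes "sets M = sets borel"
  shows "AE x in M. x \<in> msupport M"
  by (rule AE_I[of _ _ "- msupport M"])
    (use assms emeasure_compl_msupport[OF assms] in auto)

lemma emeasure_disjoint_msupport:
  fixes M :: "'a::second_countable_topology measure"
  assumes "sets M = sets borel" "A \<inter> msupport M = {}"
  shows "emeasure M A = 0"
proof -
  have "emeasure M A \<le> emeasure M (- msupport M)"
    using assms by (intro emeasure_mono) auto
  then show ?thesis using emeasure_compl_msupport[OF assms(1)] by simp
qed

lemma uniform_measure_dimD:
  assumes "uniform_measure_dim m \<mu>"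
  shows "sets \<mu> = sets borel" "space \<mu> = UNIV" "0 \<in> msupport \<mu>"
    and "\<And>x r. x \<in> msupport \<mu> \<Longrightarrow> 0 < r \<Longrightarrow> emeasure \<mu> (kball x r) = ennreal (r ^ m)"
    and "\<And>K. compact K \<Longrightarrow> emeasure \<mu> K < \<infinity>"
  using assms sets_eq_imp_space_eq[of \<mu> borel]
  by (auto simp: uniform_measure_dim_def radon_measure_def)

lemma emeasure_bounded_finite:
  fixes M :: "'a::euclidean_space measure"
  assumes "sets M = sets borel" "\<And>K. compact K \<Longrightarrow> emeasure M K < \<infinity>" "bounded A"
  shows "emeasure M A < \<infinity>"
proof -
  have "emeasure M A \<le> emeasure M (closure A)"
    using assms(1) by (intro emeasure_mono closure_subset) auto
  then show ?thesis
    using assms(2)[of "closure A"] assms(3) by (auto simp: compact_closure intro: le_less_trans)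
qed

lemma locally_finite_sigma_finite:
  fixes M :: "'a::euclidean_space measure"
  assumes "sets M = sets borel" "\<And>K. compact K \<Longrightarrow> emeasure M K < \<infinity>"
  shows "sigma_finite_measure M"
proof
  let ?A = "range (\<lambda>n::nat. cball (0::'a) (real n))"
  have "space M = UNIV" using sets_eq_imp_space_eq[OF assms(1)] by simp
  moreover have "\<Union>?A = UNIV"
    using real_arch_simple by fastforce
  moreover have "\<forall>a \<in> ?A. emeasure M a \<noteq> \<infinity>"
    using assms(2) by (auto simp: less_top)
  ultimately show "\<exists>A. countable A \<and> A \<subseteq> sets M \<and> \<Union>A = space M \<and> (\<forall>a\<in>A. emeasure M a \<noteq> \<infinity>)"
    using assms(1) by (intro exI[of _ ?A]) auto
qed

lemma measure_eqI_bounded_open: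
  fixes M N :: "'a::euclidean_space measure"
  assumes M: "sets M = sets borel" "\<And>K. compact K \<Longrightarrow> emeasure M K < \<infinity>"
    and N: "sets N = sets borel"
    and eq: "\<And>U. open U \<Longrightarrow> bounded U \<Longrightarrow> emeasure M U = emeasure N U"
  shows "M = N"
proof (rule measure_eqI_generator_eq)
  show "Int_stable (Collect (open :: 'a set \<Rightarrow> bool))"
    by (auto simp: Int_stable_def)
  show "sets M = sigma_sets UNIV (Collect open)" "sets N = sigma_sets UNIV (Collect open)"
    using M N by (simp_all add: borel_def)
  show "emeasure M U = emeasure N U" if "U \<in> Collect open" for U
  proof -
    let ?B = "\<lambda>n::nat. U \<inter> ball 0 (real n)"
    have incs: "incseq ?B"
      by (auto simp: incseq_def)
    have un: "(\<Union>n. ?B n) = U"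
      using reals_Archimedean2 by fastforce
    have sM: "range ?B \<subseteq> sets M" and sN: "range ?B \<subseteq> sets N"
      using that M N by auto
    have "emeasure M (?B n) = emeasure N (?B n)" for n
      using that by (intro eq) (auto intro: bounded_subset[OF bounded_ball])
    then show ?thesis
      using SUP_emeasure_incseq[OF sM incs] SUP_emeasure_incseq[OF sN incs] un by simp
  qed
  show "range (\<lambda>n. ball 0 (real n)) \<subseteq> Collect open" by auto
  show "(\<Union>n. ball (0::'a) (real n)) = UNIV"
    using reals_Archimedean2 by fastforce
  show "emeasure M (ball 0 (real n)) \<noteq> \<infinity>" for n
    using emeasure_bounded_finite[OF M, of "ball 0 (real n)"] by auto
qed auto

lemma integrable_continuous_compact:
  fixes f :: "'a::t2_space \<Rightarrow> real"
  assumes M: "sets M = sets borel" and K: "compact K" "emeasure M K < \<infinity>"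
    and f: "continuous_on UNIV f" "\<And>z. z \<notin> K \<Longrightarrow> f z = 0"
  shows "integrable M f"
proof -
  have "compact (f ` K)"
    by (intro compact_continuous_image K continuous_on_subset[OF f(1)]) auto
  then obtain B where B: "\<And>z. z \<in> K \<Longrightarrow> norm (f z) \<le> B"
    using compact_imp_bounded[of "f ` K"] by (auto simp: bounded_iff)
  show ?thesis
  proof (rule integrableI_bounded_set[of K M f B])
    show "f \<in> borel_measurable M"
      unfolding measurable_cong_sets[OF M refl] using f(1) by (rule borel_measurable_continuous_onI)
    show "K \<in> sets M"
      using M K(1) by (simp add: borel_compact)
  qed (use f B K in auto)
qed

lemma continuous_bounded_on_compact:
  fixes f :: "'a::topological_space \<Rightarrow> real"
  assumes "compact K" "continuous_on UNIV f"
  obtains B where "0 \<le> B" "\<And>z. z \<in> K \<Longrightarrow> \<bar>f z\<bar> \<le> B"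
proof -
  have "compact (f ` K)"
    by (intro compact_continuous_image assms continuous_on_subset[OF assms(2)]) auto
  then obtain B where B: "0 < B" "\<And>z. z \<in> K \<Longrightarrow> norm (f z) \<le> B"
    using compact_imp_bounded[of "f ` K"] by (auto simp: bounded_pos)
  then show thesis by (intro that[of B]) auto
qed

lemma integral_pos_msupport:
  fixes f :: "'a::t2_space \<Rightarrow> real"
  assumes M: "sets M = sets borel" "compact K" "emeasure M K < \<infinity>"
    and f: "continuous_on UNIV f" "\<And>z. z \<notin> K \<Longrightarrow> f z = 0" "\<And>z. 0 \<le> f z"
    and x: "x \<in> msupport M" "0 < f x"
  shows "0 < (\<integral>z. f z \<partial>M)"
proof -
  have int: "integrable M f" by (rule integrable_continuous_compact[OF M f(1,2)])
  have op: "open {z. 0 < f z}"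
    using f(1) by (intro open_Collect_less continuous_intros)
  then have pos: "0 < emeasure M {z. 0 < f z}"
    using x by (auto simp: msupport_def)
  have "(\<integral>z. f z \<partial>M) \<noteq> 0"
  proof
    assume "(\<integral>z. f z \<partial>M) = 0"
    then have "AE z in M. f z = 0"
      using integral_nonneg_eq_0_iff_AE[OF int] f(3) by simp
    then have "AE z in M. z \<notin> {z. 0 < f z}" by auto
    moreover have "{z. 0 < f z} \<in> sets M" using op M(1) by auto
    ultimately have "emeasure M {z. 0 < f z} = 0"
      using sets_eq_imp_space_eq[OF M(1)] by (subst (asm) AE_iff_measurable[of "{z. 0 < f z}"]) auto
    then show False using pos by simp
  qed
  moreover have "0 \<le> (\<integral>z. f z \<partial>M)" using f(3) by (simp add: integral_nonneg)
  ultimately show ?thesis by simp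
qed

section \<open>Comparison of uniform measures\<close>

text \<open>
  Averaging the indicator of \<open>{(x, y). d x y \<le> r}\<close> over \<open>U \<times> U\<close> against \<open>\<mu> \<times> \<nu>\<close> in both
  orders and letting \<open>r\<close> tend to \<open>0\<close> compares the two measures without a covering theorem.
  Dividing by \<open>r ^ m\<close>, the inner \<open>\<nu>\<close>-integral is eventually \<open>1\<close> at every point of
  \<open>U \<inter> msupport \<mu>\<close>; the inner \<open>\<mu>\<close>-integral is eventually \<open>1\<close> on the support of \<open>\<mu>\<close> and
  eventually \<open>0\<close> off that closed set.  Both are bounded, the second by \<open>2 ^ m\<close>, because a ball that
  meets the support lies in a ball of twice the radius around a point of the support.
\<close>

lemma uniform_measure_eq_restricted:
  fixes \<mu> \<nu> :: "'n::finite heis measure"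
  assumes mu: "uniform_measure_dim m \<mu>" and nu: "uniform_measure_dim m \<nu>"
    and U: "open U" "bounded U" and sub: "msupport \<mu> \<inter> U \<subseteq> msupport \<nu>"
  shows "emeasure \<mu> U = emeasure \<nu> (U \<inter> msupport \<mu>)"
proof -
  note mu' = uniform_measure_dimD[OF mu] and nu' = uniform_measure_dimD[OF nu]
  have [measurable_cong]: "sets \<mu> = sets borel" "sets \<nu> = sets borel"
    using mu' nu' by auto
  have [measurable]: "U \<in> sets borel" using U by auto
  interpret mu: sigma_finite_measure \<mu> by (intro locally_finite_sigma_finite mu')
  interpret nu: sigma_finite_measure \<nu> by (intro locally_finite_sigma_finite nu')
  interpret pair_sigma_finite \<mu> \<nu> ..
  define r where "r k = 1 / real (Suc k)" for k
  have r: "0 < r k" for k by (simp add: r_def)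
  have "r \<longlonglongrightarrow> 0" unfolding r_def by (rule LIMSEQ_Suc[OF lim_1_over_n])
  then have r_lim: "filterlim r (at_right 0) sequentially"
    by (rule tendsto_imp_filterlim_at_right) (simp add: r)
  define c where "c k = ennreal (1 / r k ^ m)" for k
  have c: "c k * ennreal (r k ^ m) = 1" for k
    using r[of k] by (simp add: c_def flip: ennreal_mult)
  define h where "h k x y = c k * (indicator U x * (indicator U y *
    indicator {p. koranyi_dist (fst p) (snd p) \<le> r k} (x, y)))" for k and x y :: "'n heis"
  have [measurable]: "{p :: 'n heis \<times> 'n heis. koranyi_dist (fst p) (snd p) \<le> r k} \<in> sets (borel \<Otimes>\<^sub>M borel)" for k
    unfolding borel_prod by (intro borel_closed closed_Collect_le continuous_intros)
  have h_meas [measurable]: "case_prod (h k) \<in> borel_measurable (\<mu> \<Otimes>\<^sub>M \<nu>)" for k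
    unfolding h_def by measurable
  have inner_nu: "(\<integral>\<^sup>+ y. h k x y \<partial>\<nu>) = c k * (indicator U x * emeasure \<nu> (U \<inter> kball x (r k)))" for k x
  proof -
    have "(\<integral>\<^sup>+ y. h k x y \<partial>\<nu>) = (\<integral>\<^sup>+ y. (c k * indicator U x) * indicator (U \<inter> kball x (r k)) y \<partial>\<nu>)"
      by (intro nn_integral_cong) (auto simp: h_def kball_def indicator_def)
    then show ?thesis by (simp add: nn_integral_cmult mult.assoc)
  qed
  have inner_mu: "(\<integral>\<^sup>+ x. h k x y \<partial>\<mu>) = c k * (indicator U y * emeasure \<mu> (U \<inter> kball y (r k)))" for k y
  proof -
    have "(\<integral>\<^sup>+ x. h k x y \<partial>\<mu>) = (\<integral>\<^sup>+ x. (c k * indicator U y) * indicator (U \<inter> kball y (r k)) x \<partial>\<mu>)"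
      by (intro nn_integral_cong) (auto simp: h_def kball_def indicator_def koranyi_dist_commute)
    then show ?thesis by (simp add: nn_integral_cmult mult.assoc)
  qed
  have small: "\<forall>\<^sub>F k in sequentially. kball x (r k) \<subseteq> W" if "open W" "x \<in> W" for x and W :: "'n heis set"
    using eventually_compose_filterlim[OF eventually_kball_subset[OF that] r_lim] .
  have fin: "emeasure \<mu> U < \<infinity>" "emeasure \<nu> U < \<infinity>"
    using emeasure_bounded_finite[OF mu'(1,5) U(2)] emeasure_bounded_finite[OF nu'(1,5) U(2)]
    by auto
  have lim1: "(\<lambda>k. \<integral>\<^sup>+ x. (\<integral>\<^sup>+ y. h k x y \<partial>\<nu>) \<partial>\<mu>) \<longlonglongrightarrow> (\<integral>\<^sup>+ x. indicator U x \<partial>\<mu>)"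
  proof (rule nn_integral_dominated_convergence)
    show "(\<lambda>x. \<integral>\<^sup>+ y. h k x y \<partial>\<nu>) \<in> borel_measurable \<mu>" for k
      by measurable
    show "AE x in \<mu>. (\<integral>\<^sup>+ y. h k x y \<partial>\<nu>) \<le> indicator U x" for k
      using AE_msupport[OF mu'(1)]
    proof eventually_elim
      case (elim x)
      show ?case
      proof (cases "x \<in> U")
        case True
        then have "emeasure \<nu> (U \<inter> kball x (r k)) \<le> ennreal (r k ^ m)"
          using nu'(4)[of x "r k"] r[of k] elim sub
            emeasure_mono[of "U \<inter> kball x (r k)" "kball x (r k)" \<nu>] by auto
        then have "c k * emeasure \<nu> (U \<inter> kball x (r k)) \<le> c k * ennreal (r k ^ m)"
          by (rule mult_left_mono) simp
        then show ?thesis using True by (simp add: inner_nu c)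
      qed (simp add: inner_nu)
    qed
    show "AE x in \<mu>. (\<lambda>k. \<integral>\<^sup>+ y. h k x y \<partial>\<nu>) \<longlonglongrightarrow> indicator U x"
      using AE_msupport[OF mu'(1)]
    proof eventually_elim
      case (elim x)
      show ?case
      proof (cases "x \<in> U")
        case True
        have "\<forall>\<^sub>F k in sequentially. (\<integral>\<^sup>+ y. h k x y \<partial>\<nu>) = 1"
          using small[OF U(1) True]
        proof eventually_elim
          case (elim k)
          then have "U \<inter> kball x (r k) = kball x (r k)" by auto
          then show ?case
            using True nu'(4)[of x "r k"] r[of k] \<open>x \<in> msupport \<mu>\<close> sub by (auto simp: inner_nu c)
        qed
        then show ?thesis using True by (simp add: tendsto_eventually)
      qed (simp add: inner_nu)
    qed
  qed (use fin in auto)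
  have lim2: "(\<lambda>k. \<integral>\<^sup>+ y. (\<integral>\<^sup>+ x. h k x y \<partial>\<mu>) \<partial>\<nu>) \<longlonglongrightarrow> (\<integral>\<^sup>+ y. indicator (U \<inter> msupport \<mu>) y \<partial>\<nu>)"
  proof (rule nn_integral_dominated_convergence)
    show "(\<lambda>y. \<integral>\<^sup>+ x. h k x y \<partial>\<mu>) \<in> borel_measurable \<nu>" for k
      by measurable
    show "AE y in \<nu>. (\<integral>\<^sup>+ x. h k x y \<partial>\<mu>) \<le> 2 ^ m * indicator U y" for k
    proof (rule AE_I2)
      fix y
      have "emeasure \<mu> (U \<inter> kball y (r k)) \<le> ennreal ((2 * r k) ^ m)"
      proof (cases "U \<inter> kball y (r k) \<inter> msupport \<mu> = {}")
        case True
        then show ?thesis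
          using emeasure_disjoint_msupport[OF mu'(1) True] by simp
      next
        case False
        then obtain x where x: "x \<in> kball y (r k)" "x \<in> msupport \<mu>" by auto
        have "U \<inter> kball y (r k) \<subseteq> kball x (2 * r k)"
        proof
          fix z assume "z \<in> U \<inter> kball y (r k)"
          then show "z \<in> kball x (2 * r k)"
            using x(1) koranyi_dist_triangle[of x z y] by (simp add: kball_def koranyi_dist_commute)
        qed
        then have "emeasure \<mu> (U \<inter> kball y (r k)) \<le> emeasure \<mu> (kball x (2 * r k))"
          by (intro emeasure_mono) (auto simp: mu'(1))
        then show ?thesis using mu'(4)[OF x(2), of "2 * r k"] r[of k] by simp
      qed
      then have "c k * emeasure \<mu> (U \<inter> kball y (r k)) \<le> c k * ennreal ((2 * r k) ^ m)"
        by (rule mult_left_mono) simp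
      also have "\<dots> = 2 ^ m * (c k * ennreal (r k ^ m))"
        using r[of k] by (simp add: power_mult_distrib ennreal_mult ennreal_power[symmetric] mult_ac)
      finally show "(\<integral>\<^sup>+ x. h k x y \<partial>\<mu>) \<le> 2 ^ m * indicator U y"
        by (cases "y \<in> U") (simp_all add: inner_mu c)
    qed
    show "AE y in \<nu>. (\<lambda>k. \<integral>\<^sup>+ x. h k x y \<partial>\<mu>) \<longlonglongrightarrow> indicator (U \<inter> msupport \<mu>) y"
    proof (rule AE_I2)
      fix y
      consider "y \<notin> U" | "y \<in> U" "y \<in> msupport \<mu>" | "y \<in> U" "y \<in> - msupport \<mu>" by auto
      then show "(\<lambda>k. \<integral>\<^sup>+ x. h k x y \<partial>\<mu>) \<longlonglongrightarrow> indicator (U \<inter> msupport \<mu>) y"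
      proof cases
        case 1
        then show ?thesis by (simp add: inner_mu)
      next
        case 2
        have "\<forall>\<^sub>F k in sequentially. (\<integral>\<^sup>+ x. h k x y \<partial>\<mu>) = 1"
          using small[OF U(1) 2(1)]
        proof eventually_elim
          case (elim k)
          then have "U \<inter> kball y (r k) = kball y (r k)" by auto
          then show ?case using 2 mu'(4)[of y "r k"] r[of k] by (auto simp: inner_mu c)
        qed
        then show ?thesis using 2 by (simp add: tendsto_eventually)
      next
        case 3
        have "\<forall>\<^sub>F k in sequentially. (\<integral>\<^sup>+ x. h k x y \<partial>\<mu>) = 0"
          using small[OF open_compl_msupport 3(2)]
        proof eventually_elim
          case (elim k)
          then have "U \<inter> kball y (r k) \<inter> msupport \<mu> = {}" by auto
          then show ?case using emeasure_disjoint_msupport[OF mu'(1)] by (simp add: inner_mu)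
        qed
        then show ?thesis using 3 by (simp add: tendsto_eventually)
      qed
    qed
  qed (use fin in \<open>auto simp: nn_integral_cmult ennreal_mult_less_top power_less_top_ennreal\<close>)
  have "(\<lambda>k. \<integral>\<^sup>+ x. (\<integral>\<^sup>+ y. h k x y \<partial>\<nu>) \<partial>\<mu>) = (\<lambda>k. \<integral>\<^sup>+ y. (\<integral>\<^sup>+ x. h k x y \<partial>\<mu>) \<partial>\<nu>)"
    using Fubini'[OF h_meas] by simp
  then have "(\<integral>\<^sup>+ x. indicator U x \<partial>\<mu>) = (\<integral>\<^sup>+ y. indicator (U \<inter> msupport \<mu>) y \<partial>\<nu>)"
    using lim1 lim2 by (simp add: LIMSEQ_unique)
  then show ?thesis by simp
qed

text \<open>
  With equal supports the comparison applies to every bounded open set, so a uniform measure is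
  determined by its support.
\<close>

lemma uniform_measure_eqI:
  assumes mu: "uniform_measure_dim m \<mu>" and nu: "uniform_measure_dim m \<nu>"
    and eq: "msupport \<mu> = msupport \<nu>"
  shows "\<mu> = \<nu>"
proof (rule measure_eqI_bounded_open)
  note mu' = uniform_measure_dimD[OF mu] and nu' = uniform_measure_dimD[OF nu]
  show "sets \<mu> = sets borel" "sets \<nu> = sets borel" "\<And>K. compact K \<Longrightarrow> emeasure \<mu> K < \<infinity>"
    using mu' nu' by auto
  fix U :: "'a heis set" assume U: "open U" "bounded U"
  have "emeasure \<mu> U = emeasure \<nu> (U \<inter> msupport \<nu>)"
    using uniform_measure_eq_restricted[OF mu nu U] eq by auto
  also have "\<dots> = emeasure \<nu> U"
    using U nu'(1) AE_msupport[OF nu'(1)] by (intro emeasure_eq_AE) auto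
  finally show "emeasure \<mu> U = emeasure \<nu> U" .
qed

lemma uniform_measure_open_ball:
  assumes mu: "uniform_measure_dim m \<mu>" and x: "x \<in> msupport \<mu>" and r: "0 < r"
  shows "emeasure \<mu> {z. koranyi_dist x z < r} = ennreal (r ^ m)"
proof (rule antisym)
  note mu' = uniform_measure_dimD[OF mu]
  have B: "{z. koranyi_dist x z < r} \<in> sets \<mu>"
    using open_koranyi_ball[of x r] mu'(1) by simp
  have "emeasure \<mu> {z. koranyi_dist x z < r} \<le> emeasure \<mu> (kball x r)"
    by (rule emeasure_mono) (simp_all add: mu'(1) kball_in_borel, simp add: kball_def subset_iff)
  then show "emeasure \<mu> {z. koranyi_dist x z < r} \<le> ennreal (r ^ m)"
    using mu'(4)[OF x r] by simp
  show "ennreal (r ^ m) \<le> emeasure \<mu> {z. koranyi_dist x z < r}"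
  proof (rule tendsto_upperbound)
    show "((\<lambda>s. ennreal (s ^ m)) \<longlongrightarrow> ennreal (r ^ m)) (at_left r)"
      by (intro tendsto_intros)
    show "\<forall>\<^sub>F s in at_left r. ennreal (s ^ m) \<le> emeasure \<mu> {z. koranyi_dist x z < r}"
    proof (rule eventually_at_leftI[of 0 r])
      fix s assume s: "s \<in> {0<..<r}"
      have "emeasure \<mu> (kball x s) \<le> emeasure \<mu> {z. koranyi_dist x z < r}"
        using s B by (intro emeasure_mono) (auto simp: kball_def)
      then show "ennreal (s ^ m) \<le> emeasure \<mu> {z. koranyi_dist x z < r}"
        using mu'(4)[OF x, of s] s by simp
    qed (rule r)
  qed simp
qed

section \<open>Taylor expansion of a radial cutoff under small translations\<close>

text \<open>
  The fourth power of the positive part has Lipschitz second derivative near \<open>0\<close>, so its second-order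
  expansion has a cubic error even across the kink.  If \<open>a\<close> and \<open>a + h\<close> have opposite signs, then
  \<open>\<bar>a\<bar> \<le> \<bar>h\<bar>\<close> and every term is at most a multiple of \<open>\<bar>h\<bar> ^ 4\<close>; \<open>11 = 1 + 4 + 6\<close> collects the
  coefficients.
\<close>

lemma positive_part_pow4_expansion:
  fixes a h :: real
  shows "\<bar>max 0 (a + h) ^ 4 - max 0 a ^ 4 - 4 * max 0 a ^ 3 * h - 6 * (max 0 a)\<^sup>2 * h\<^sup>2\<bar>
    \<le> 4 * max 0 a * \<bar>h\<bar> ^ 3 + 11 * \<bar>h\<bar> ^ 4"
proof (cases "0 \<le> a")
  case True
  show ?thesis
  proof (cases "0 \<le> a + h")
    case nn: True
    have "(a + h) ^ 4 - a ^ 4 - 4 * a ^ 3 * h - 6 * a\<^sup>2 * h\<^sup>2 = 4 * a * h ^ 3 + h ^ 4"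
      by algebra
    moreover have "\<bar>4 * a * h ^ 3 + h ^ 4\<bar> \<le> 4 * a * \<bar>h\<bar> ^ 3 + \<bar>h\<bar> ^ 4"
      using True by (intro order_trans[OF abs_triangle_ineq]) (simp add: abs_mult power_abs)
    moreover have "\<dots> \<le> 4 * a * \<bar>h\<bar> ^ 3 + 11 * \<bar>h\<bar> ^ 4"
      using zero_le_power[of "\<bar>h\<bar>" 4] by linarith
    ultimately show ?thesis using True nn by (simp only: max_absorb2)
  next
    case False
    define k where "k = - h"
    have k: "0 \<le> k" "a \<le> k" "h = - k" using False True by (auto simp: k_def)
    have "a ^ 4 \<le> k ^ 4" "a ^ 3 * k \<le> k ^ 3 * k" "a\<^sup>2 * k\<^sup>2 \<le> k\<^sup>2 * k\<^sup>2"
      using k True by (intro power_mono mult_right_mono; simp)+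
    moreover have "k ^ 3 * k = k ^ 4" "k\<^sup>2 * k\<^sup>2 = k ^ 4" by algebra+
    moreover have "0 \<le> a ^ 4" "0 \<le> a ^ 3 * k" "0 \<le> a\<^sup>2 * k\<^sup>2" "0 \<le> a * k ^ 3"
      using True k by auto
    ultimately have "\<bar>- (a ^ 4) + 4 * (a ^ 3 * k) - 6 * (a\<^sup>2 * k\<^sup>2)\<bar> \<le> 4 * (a * k ^ 3) + 11 * k ^ 4"
      by linarith
    moreover have "max 0 (a + h) ^ 4 - max 0 a ^ 4 - 4 * max 0 a ^ 3 * h - 6 * (max 0 a)\<^sup>2 * h\<^sup>2
        = - (a ^ 4) + 4 * (a ^ 3 * k) - 6 * (a\<^sup>2 * k\<^sup>2)"
      using True False k by simp
    moreover have "4 * max 0 a * \<bar>h\<bar> ^ 3 + 11 * \<bar>h\<bar> ^ 4 = 4 * (a * k ^ 3) + 11 * k ^ 4"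
      using True k by simp
    ultimately show ?thesis by (simp only:)
  qed
next
  case False
  have "max 0 (a + h) \<le> \<bar>h\<bar>" using False by auto
  then have "max 0 (a + h) ^ 4 \<le> \<bar>h\<bar> ^ 4" by (intro power_mono) auto
  also have "\<dots> \<le> 11 * \<bar>h\<bar> ^ 4" by simp
  finally show ?thesis using False by simp
qed

lemma positive_part_pow3_expansion:
  fixes a h :: real
  shows "\<bar>max 0 (a + h) ^ 3 - max 0 a ^ 3 - 3 * (max 0 a)\<^sup>2 * h\<bar>
    \<le> 3 * max 0 a * \<bar>h\<bar>\<^sup>2 + 4 * \<bar>h\<bar> ^ 3"
proof (cases "0 \<le> a")
  case True
  show ?thesis
  proof (cases "0 \<le> a + h")
    case nn: True
    have "(a + h) ^ 3 - a ^ 3 - 3 * a\<^sup>2 * h = 3 * a * h\<^sup>2 + h ^ 3"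
      by algebra
    moreover have "\<bar>3 * a * h\<^sup>2 + h ^ 3\<bar> \<le> 3 * a * \<bar>h\<bar>\<^sup>2 + \<bar>h\<bar> ^ 3"
      using True by (intro order_trans[OF abs_triangle_ineq]) (simp add: abs_mult power_abs)
    moreover have "\<dots> \<le> 3 * a * \<bar>h\<bar>\<^sup>2 + 4 * \<bar>h\<bar> ^ 3"
      using zero_le_power[of "\<bar>h\<bar>" 3] by linarith
    ultimately show ?thesis using True nn by (simp only: max_absorb2)
  next
    case False
    define k where "k = - h"
    have k: "0 \<le> k" "a \<le> k" "h = - k" using False True by (auto simp: k_def)
    have "a ^ 3 \<le> k ^ 3" "a\<^sup>2 * k \<le> k\<^sup>2 * k"
      using k True by (intro power_mono mult_right_mono; simp)+
    moreover have "k\<^sup>2 * k = k ^ 3" by algebra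
    moreover have "0 \<le> a ^ 3" "0 \<le> a\<^sup>2 * k" "0 \<le> a * k\<^sup>2"
      using True k by auto
    ultimately have "\<bar>- (a ^ 3) + 3 * (a\<^sup>2 * k)\<bar> \<le> 3 * (a * k\<^sup>2) + 4 * k ^ 3"
      by linarith
    moreover have "max 0 (a + h) ^ 3 - max 0 a ^ 3 - 3 * (max 0 a)\<^sup>2 * h = - (a ^ 3) + 3 * (a\<^sup>2 * k)"
      using True False k by simp
    moreover have "3 * max 0 a * \<bar>h\<bar>\<^sup>2 + 4 * \<bar>h\<bar> ^ 3 = 3 * (a * k\<^sup>2) + 4 * k ^ 3"
      using True k by simp
    ultimately show ?thesis by (simp only:)
  qed
next
  case False
  have "max 0 (a + h) \<le> \<bar>h\<bar>" using False by auto
  then have "max 0 (a + h) ^ 3 \<le> \<bar>h\<bar> ^ 3" by (intro power_mono) auto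
  also have "\<dots> \<le> 4 * \<bar>h\<bar> ^ 3" by simp
  finally show ?thesis using False by simp
qed

text \<open>
  The fourth power of this cutoff is the radial test function of the proof: it vanishes outside the
  unit ball, so that vague convergence applies to it directly, and it is regular enough for a
  second-order expansion.  As a function of the polynomial \<open>kor4\<close> it can be expanded explicitly.
\<close>

definition bump :: "'n::finite heis \<Rightarrow> real" where
  "bump z = max 0 (1 - kor4 z)"

lemma bump_nonneg [simp]: "0 \<le> bump z" and bump_le_1: "bump z \<le> 1"
  by (simp_all add: bump_def)

lemma continuous_on_bump [continuous_intros]:
  "continuous_on S f \<Longrightarrow> continuous_on S (\<lambda>x. bump (f x))"
  unfolding bump_def by (intro continuous_intros)

lemma bump_eq_0: "1 \<le> koranyi_norm z \<Longrightarrow> bump z = 0"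
  using one_le_power[of "koranyi_norm z" 4] by (simp add: bump_def koranyi_norm_pow4)

lemma bump_outside_kball: "z \<notin> kball 0 2 \<Longrightarrow> bump z = 0"
  by (rule bump_eq_0) (simp add: kball_def)

lemma bump_translate_outside_kball:
  assumes "koranyi_norm y \<le> 1" "z \<notin> kball 0 2"
  shows "bump (hinv y \<star> z) = 0"
proof (rule bump_eq_0)
  have "koranyi_norm z \<le> koranyi_norm y + koranyi_norm (hinv y \<star> z)"
    using koranyi_norm_triangle[of y "hinv y \<star> z"] by simp
  then show "1 \<le> koranyi_norm (hinv y \<star> z)"
    using assms by (simp add: kball_def)
qed

text \<open>
  The derivative of \<open>kor4\<close> at \<open>z\<close> under left translations in the horizontal direction \<open>h\<close> is
  \<open>4 * (h \<bullet> kgrad z)\<close>.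
\<close>

definition kgrad :: "'n::finite heis \<Rightarrow> 'n hvec" where
  "kgrad z = (norm (fst z))\<^sup>2 *\<^sub>R fst z + snd z *\<^sub>R sympJ (fst z)"

lemma continuous_on_kgrad [continuous_intros]:
  "continuous_on S f \<Longrightarrow> continuous_on S (\<lambda>x. kgrad (f x))"
  unfolding kgrad_def by (intro continuous_intros)

definition kquad :: "'n::finite heis \<Rightarrow> 'n heis \<Rightarrow> real" where
  "kquad x z = 2 * snd x * snd z - 4 * (fst x \<bullet> fst z)\<^sup>2 - 4 * (fst x \<bullet> sympJ (fst z))\<^sup>2
     - 2 * (norm (fst x))\<^sup>2 * (norm (fst z))\<^sup>2"

definition kcubic :: "'n::finite heis \<Rightarrow> 'n heis \<Rightarrow> real" where
  "kcubic x z = 4 * (norm (fst x))\<^sup>2 * (fst x \<bullet> fst z) - 4 * snd x * (fst x \<bullet> sympJ (fst z))"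

lemma kor4_translate_dilation:
  "kor4 (hinv (dilation e x) \<star> z) = kor4 z -
    (e * (4 * (fst x \<bullet> kgrad z)) + e\<^sup>2 * kquad x z + e ^ 3 * kcubic x z - e ^ 4 * kor4 x)"
proof -
  have n4: "norm v ^ 4 = (v \<bullet> v)\<^sup>2" for v :: "'a hvec"
    by (simp add: power2_norm_eq_inner[symmetric] flip: power_mult)
  define a b c d where "a = fst x \<bullet> fst z" and "b = fst x \<bullet> sympJ (fst z)"
    and "c = fst x \<bullet> fst x" and "d = fst z \<bullet> fst z"
  have zx: "fst z \<bullet> fst x = a" by (simp add: a_def inner_commute)
  show ?thesis
    unfolding kor4_def kquad_def kcubic_def kgrad_def hinv_hmult dilation_def n4 power2_norm_eq_inner
    by (simp add: inner_diff_left inner_diff_right inner_add_right zx flip: a_def b_def c_def d_def)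
      algebra
qed

text \<open>
  The coefficient of \<open>e\<^sup>2\<close> in the expansion of \<open>bump (hinv (dilation e x) \<star> z) ^ 4\<close>.  The vertical
  part of \<open>x\<close> already enters at this order because dilations act on it by \<open>e\<^sup>2\<close>.
\<close>

definition second_order :: "'n::finite heis \<Rightarrow> 'n heis \<Rightarrow> real" where
  "second_order x z = 4 * bump z ^ 3 * kquad x z + 6 * (bump z)\<^sup>2 * (4 * (fst x \<bullet> kgrad z))\<^sup>2"

lemma continuous_on_second_order: "continuous_on S (second_order x)"
  unfolding second_order_def kquad_def by (intro continuous_intros)

lemma second_order_outside_kball: "z \<notin> kball 0 2 \<Longrightarrow> second_order x z = 0"
  by (simp add: second_order_def bump_outside_kball)

text \<open>
  The error bound is supported in a fixed compact set: for small \<open>e\<close>, translating by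
  \<open>dilation e x\<close> moves the unit ball into the ball of radius \<open>2\<close>.
\<close>

lemma bump_translate_expansion:
  fixes x :: "'n::finite heis"
  obtains C where "0 \<le> C" "\<And>e z. 0 < e \<Longrightarrow> e \<le> 1 \<Longrightarrow> e * koranyi_norm x \<le> 1 \<Longrightarrow>
    \<bar>bump (hinv (dilation e x) \<star> z) ^ 4 - bump z ^ 4 - e * (16 * bump z ^ 3 * (fst x \<bullet> kgrad z))
       - e\<^sup>2 * second_order x z\<bar> \<le> C * e ^ 3 * indicator (kball 0 2) z"
proof -
  have comp: "compact (kball (0 :: 'n heis) 2)" by simp
  obtain B1 where B1: "0 \<le> B1" "\<And>z. z \<in> kball 0 2 \<Longrightarrow> \<bar>4 * (fst x \<bullet> kgrad z)\<bar> \<le> B1"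
    by (rule continuous_bounded_on_compact[OF comp, of "\<lambda>z. 4 * (fst x \<bullet> kgrad z)"])
      (intro continuous_intros, auto)
  obtain B2 where B2: "0 \<le> B2" "\<And>z. z \<in> kball 0 2 \<Longrightarrow> \<bar>kquad x z\<bar> \<le> B2"
    by (rule continuous_bounded_on_compact[OF comp, of "kquad x"])
      (unfold kquad_def, intro continuous_intros, auto)
  obtain B3 where B3: "0 \<le> B3" "\<And>z. z \<in> kball 0 2 \<Longrightarrow> \<bar>kcubic x z\<bar> \<le> B3"
    by (rule continuous_bounded_on_compact[OF comp, of "kcubic x"])
      (unfold kcubic_def, intro continuous_intros, auto)
  define B where "B = B1 + B2 + B3 + kor4 x"
  have B: "0 \<le> B" "B1 \<le> B" "B2 \<le> B" "B3 \<le> B" "kor4 x \<le> B"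
    using B1(1) B2(1) B3(1) kor4_nonneg[of x] by (auto simp: B_def)
  \<comment> \<open>The first two terms bound the Taylor error for the increment \<open>h\<close> below, the last two the
    replacement of \<open>h\<close> and \<open>h\<^sup>2\<close> by their parts of order at most two in \<open>e\<close>.\<close>
  define C where "C = 4 * (4 * B) ^ 3 + 11 * (4 * B) ^ 4 + 8 * B + 90 * B\<^sup>2"
  have "0 \<le> C" using B(1) by (simp add: C_def)
  moreover have "\<bar>bump (hinv (dilation e x) \<star> z) ^ 4 - bump z ^ 4
      - e * (16 * bump z ^ 3 * (fst x \<bullet> kgrad z)) - e\<^sup>2 * second_order x z\<bar>
      \<le> C * e ^ 3 * indicator (kball 0 2) z"
    if e: "0 < e" "e \<le> 1" "e * koranyi_norm x \<le> 1" for e z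
  proof (cases "z \<in> kball 0 2")
    case False
    have "koranyi_norm (dilation e x) \<le> 1"
      using e by (simp add: koranyi_norm_dilation)
    then show ?thesis
      using False by (simp add: bump_translate_outside_kball bump_outside_kball second_order_outside_kball)
  next
    case True
    define L Q T A where "L = 4 * (fst x \<bullet> kgrad z)" and "Q = kquad x z" and "T = kcubic x z"
      and "A = bump z"
    define h where "h = e * L + e\<^sup>2 * Q + e ^ 3 * T - e ^ 4 * kor4 x"
    have bd: "\<bar>L\<bar> \<le> B" "\<bar>Q\<bar> \<le> B" "\<bar>T\<bar> \<le> B" "\<bar>kor4 x\<bar> \<le> B"
      using B1(2)[OF True] B2(2)[OF True] B3(2)[OF True] B by (auto simp: L_def Q_def T_def)
    have A: "0 \<le> A" "A \<le> 1" "A\<^sup>2 \<le> 1" "A ^ 3 \<le> 1"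
      using bump_le_1[of z] by (auto simp: A_def power_le_one)
    have pw: "e\<^sup>2 \<le> e" "e ^ 3 \<le> e" "e ^ 4 \<le> e" "e ^ 3 \<le> e\<^sup>2" "e ^ 4 \<le> e\<^sup>2" "e ^ 4 \<le> e ^ 3"
      using e power_decreasing[of 1 2 e] power_decreasing[of 1 3 e] power_decreasing[of 1 4 e]
        power_decreasing[of 2 3 e] power_decreasing[of 2 4 e] power_decreasing[of 3 4 e] by auto
    have le: "\<bar>p * y\<bar> \<le> q * B" if "0 \<le> p" "p \<le> q" "\<bar>y\<bar> \<le> B" for p q y
      using mult_mono[of p q "\<bar>y\<bar>" B] that by (simp add: abs_mult)
    have L1: "\<bar>e * L\<bar> \<le> e * B"
      and Q1: "\<bar>e\<^sup>2 * Q\<bar> \<le> e * B" and Q2: "\<bar>e\<^sup>2 * Q\<bar> \<le> e\<^sup>2 * B"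
      and T1: "\<bar>e ^ 3 * T\<bar> \<le> e * B" and T2: "\<bar>e ^ 3 * T\<bar> \<le> e\<^sup>2 * B" and T3: "\<bar>e ^ 3 * T\<bar> \<le> e ^ 3 * B"
      and k1: "\<bar>e ^ 4 * kor4 x\<bar> \<le> e * B" and k2: "\<bar>e ^ 4 * kor4 x\<bar> \<le> e\<^sup>2 * B"
      and k3: "\<bar>e ^ 4 * kor4 x\<bar> \<le> e ^ 3 * B"
      by (intro le bd pw order_refl zero_le_power less_imp_le[OF e(1)])+
    have h3: "\<bar>h - e * L - e\<^sup>2 * Q\<bar> \<le> 2 * (e ^ 3 * B)"
      using T3 k3 unfolding h_def by linarith
    have h2: "\<bar>h - e * L\<bar> \<le> 3 * (e\<^sup>2 * B)"
      using Q2 T2 k2 unfolding h_def by linarith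
    have h1: "\<bar>h\<bar> \<le> 4 * (e * B)"
      using L1 Q1 T1 k1 unfolding h_def by linarith
    have "\<bar>h + e * L\<bar> \<le> 5 * (e * B)"
      using h1 L1 by linarith
    then have "\<bar>h - e * L\<bar> * \<bar>h + e * L\<bar> \<le> (3 * (e\<^sup>2 * B)) * (5 * (e * B))"
      using h2 B(1) e by (intro mult_mono) auto
    moreover have "(h - e * L) * (h + e * L) = h\<^sup>2 - e\<^sup>2 * L\<^sup>2"
      by algebra
    moreover have "(3 * (e\<^sup>2 * B)) * (5 * (e * B)) = 15 * B\<^sup>2 * e ^ 3"
      by algebra
    ultimately have sq: "\<bar>h\<^sup>2 - e\<^sup>2 * L\<^sup>2\<bar> \<le> 15 * B\<^sup>2 * e ^ 3"
      by (simp only: flip: abs_mult)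
    have mx: "bump (hinv (dilation e x) \<star> z) = max 0 ((1 - kor4 z) + h)"
      by (simp add: bump_def kor4_translate_dilation h_def L_def Q_def T_def)
    have R: "\<bar>bump (hinv (dilation e x) \<star> z) ^ 4 - A ^ 4 - 4 * A ^ 3 * h - 6 * A\<^sup>2 * h\<^sup>2\<bar>
        \<le> 4 * A * \<bar>h\<bar> ^ 3 + 11 * \<bar>h\<bar> ^ 4"
      unfolding mx unfolding A_def bump_def by (rule positive_part_pow4_expansion)
    have "4 * A * \<bar>h\<bar> ^ 3 \<le> 4 * 1 * (4 * (e * B)) ^ 3"
      using A h1 by (intro mult_mono power_mono) auto
    moreover have "\<bar>h\<bar> ^ 4 \<le> (4 * (e * B)) ^ 4"
      using h1 by (intro power_mono) auto
    moreover have "(4 * B) ^ 4 * e ^ 4 \<le> (4 * B) ^ 4 * e ^ 3"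
      using pw B(1) by (intro mult_left_mono) auto
    ultimately have R2: "4 * A * \<bar>h\<bar> ^ 3 + 11 * \<bar>h\<bar> ^ 4 \<le> (4 * (4 * B) ^ 3 + 11 * (4 * B) ^ 4) * e ^ 3"
      by (simp add: power_mult_distrib algebra_simps)
    have S1: "\<bar>4 * A ^ 3 * (h - e * L - e\<^sup>2 * Q)\<bar> \<le> 8 * B * e ^ 3"
    proof -
      have "A ^ 3 * \<bar>h - e * L - e\<^sup>2 * Q\<bar> \<le> 1 * (2 * (e ^ 3 * B))"
        using A h3 by (intro mult_mono) auto
      then show ?thesis using A(1) by (simp add: abs_mult mult_ac)
    qed
    have S2: "\<bar>6 * A\<^sup>2 * (h\<^sup>2 - e\<^sup>2 * L\<^sup>2)\<bar> \<le> 90 * B\<^sup>2 * e ^ 3"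
    proof -
      have "A\<^sup>2 * \<bar>h\<^sup>2 - e\<^sup>2 * L\<^sup>2\<bar> \<le> 1 * (15 * B\<^sup>2 * e ^ 3)"
        using A sq by (intro mult_mono) auto
      then show ?thesis using A(1) by (simp add: abs_mult)
    qed
    let ?P = "bump (hinv (dilation e x) \<star> z) ^ 4"
    have "?P - A ^ 4 - e * (16 * A ^ 3 * (fst x \<bullet> kgrad z)) - e\<^sup>2 * second_order x z
        = (?P - A ^ 4 - 4 * A ^ 3 * h - 6 * A\<^sup>2 * h\<^sup>2) + 4 * A ^ 3 * (h - e * L - e\<^sup>2 * Q)
          + 6 * A\<^sup>2 * (h\<^sup>2 - e\<^sup>2 * L\<^sup>2)"
      by (simp add: second_order_def L_def Q_def A_def power_mult_distrib algebra_simps)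
    then have "\<bar>?P - A ^ 4 - e * (16 * A ^ 3 * (fst x \<bullet> kgrad z)) - e\<^sup>2 * second_order x z\<bar> \<le> C * e ^ 3"
      using R R2 S1 S2 by (simp add: C_def distrib_right abs_le_iff)
    then show ?thesis using True by (simp add: A_def)
  qed
  ultimately show thesis by (rule that)
qed

section \<open>The flat measure\<close>

text \<open>
  A function that is not countably additive is turned by \<open>measure_of\<close> into the zero measure.  Hence a
  single set of nonzero measure is enough to know all values on Borel sets.
\<close>

lemma emeasure_centered_spherical_on:
  assumes "emeasure (centered_spherical_on m S) B \<noteq> 0" "A \<in> sets borel"
  shows "emeasure (centered_spherical_on m S) A = centered_spherical m (A \<inter> S)"
proof -
  have "sigma_sets UNIV (sets (borel :: 'a heis measure)) = sets borel"
    using sets.sigma_sets_eq[of "borel :: 'a heis measure"] by simp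
  then show ?thesis
    using assms by (auto simp: centered_spherical_on_def emeasure_measure_of_conv split: if_splits)
qed

lemma centered_spherical_empty [simp]: "centered_spherical m ({} :: 'n::finite heis set) = 0"
proof -
  have "centered_spherical0 m ({} :: 'n heis set) \<le> 0"
    unfolding centered_spherical0_def
  proof (rule SUP_least)
    fix \<delta> :: real
    show "Inf {(\<Sum>j. if j \<in> I then ennreal (r j ^ m) else 0) |
        (I :: nat set) (x :: nat \<Rightarrow> 'n heis) (r :: nat \<Rightarrow> real).
        {} \<subseteq> (\<Union>j \<in> I. kball (x j) (r j)) \<and>
        (\<forall>j \<in> I. x j \<in> {} \<and> 0 < r j \<and> r j \<le> \<delta>)} \<le> 0"
      by (rule Inf_lower) (auto intro!: exI[of _ "{}"])
  qed
  then show ?thesis by (simp add: centered_spherical_def)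
qed

lemma kball_translate: "hmult v ` kball x r = kball (v \<star> x) r"
proof
  show "kball (v \<star> x) r \<subseteq> hmult v ` kball x r"
  proof
    fix z assume "z \<in> kball (v \<star> x) r"
    then have "hinv v \<star> z \<in> kball x r"
      using koranyi_dist_left_invariant[of v x "hinv v \<star> z"] by (simp add: kball_def)
    then show "z \<in> hmult v ` kball x r"
      by (metis hmult_hinv_cancel(2) imageI)
  qed
qed (auto simp: kball_def)

lemma centered_spherical_translate:
  fixes v :: "'n::finite heis"
  shows "centered_spherical m (hmult v ` A) = centered_spherical m A"
proof -
  define P where "P E \<delta> = {(\<Sum>j. if j \<in> I then ennreal (r j ^ m) else 0) |
      (I :: nat set) (x :: nat \<Rightarrow> 'n heis) (r :: nat \<Rightarrow> real).
      E \<subseteq> (\<Union>j \<in> I. kball (x j) (r j)) \<and>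
      (\<forall>j \<in> I. x j \<in> E \<and> 0 < r j \<and> r j \<le> \<delta>)}" for E \<delta>
  have sub: "P E \<delta> \<subseteq> P (hmult u ` E) \<delta>" for u E \<delta>
  proof
    fix s assume "s \<in> P E \<delta>"
    then obtain I x r where s: "s = (\<Sum>j. if j \<in> I then ennreal (r j ^ m) else 0)"
      "E \<subseteq> (\<Union>j \<in> I. kball (x j) (r j))" "\<forall>j \<in> I. x j \<in> E \<and> 0 < r j \<and> r j \<le> \<delta>"
      unfolding P_def by blast
    have "hmult u ` E \<subseteq> (\<Union>j \<in> I. kball (u \<star> x j) (r j))"
      using image_mono[OF s(2), of "hmult u"] by (simp add: image_UN kball_translate)
    then show "s \<in> P (hmult u ` E) \<delta>"
      unfolding P_def using s(1,3)
      by (intro CollectI exI[of _ I] exI[of _ "\<lambda>j. u \<star> x j"] exI[of _ r]) auto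
  qed
  have "hmult (hinv v) ` hmult v ` E = E" for E
    by (simp add: image_image)
  then have "P (hmult v ` E) \<delta> = P E \<delta>" for E \<delta>
    using sub[of E \<delta> v] sub[of "hmult v ` E" \<delta> "hinv v"] by auto
  then have "centered_spherical0 m (hmult v ` E) = centered_spherical0 m E" for E
    unfolding centered_spherical0_def P_def[symmetric] by simp
  moreover have "Pow (hmult v ` A) = (`) (hmult v) ` Pow A"
    by (rule image_Pow_surj[OF refl, symmetric])
  ultimately show ?thesis
    unfolding centered_spherical_def by (simp add: image_image)
qed

lemma vplane_translate:
  assumes "v \<in> vplane \<nn>" shows "v \<star> z \<in> vplane \<nn> \<longleftrightarrow> z \<in> vplane \<nn>"
  using assms by (simp add: vplane_def hmult_def inner_add_right)

lemma closed_vplane: "closed (vplane \<nn>)"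
  unfolding vplane_def by (intro closed_Collect_eq continuous_intros)

text \<open>
  Continuous cutoffs between the indicators of concentric balls compare the masses.  Balls of radius
  smaller and larger than \<open>r\<close> then give the exact value because \<open>r ^ m\<close> is continuous in \<open>r\<close>.
\<close>

lemma vague_limit_kball:
  fixes N :: "nat \<Rightarrow> 'n::finite heis measure"
  assumes lim: "vague_limit N \<nu>"
    and N: "\<And>i. sets (N i) = sets borel"
      "\<And>i r. 0 < r \<Longrightarrow> emeasure (N i) (kball 0 r) = ennreal (r ^ m)"
    and nu: "sets \<nu> = sets borel" "\<And>K. compact K \<Longrightarrow> emeasure \<nu> K < \<infinity>"
    and r: "0 < r"
  shows "emeasure \<nu> (kball 0 r) = ennreal (r ^ m)"
proof -
  have mono: "measure M (kball 0 s) \<le> (\<integral>z. f z \<partial>M) \<and> (\<integral>z. f z \<partial>M) \<le> measure M (kball 0 t)"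
    if M: "sets M = sets borel" "emeasure M (kball 0 t) < \<infinity>" and st: "s \<le> t"
      and f: "continuous_on UNIV f" "\<And>z. indicator (kball 0 s) z \<le> f z" "\<And>z. f z \<le> indicator (kball 0 t) z"
    for M :: "'n heis measure" and f :: "'n heis \<Rightarrow> real" and s t
  proof -
    have sub: "kball (0 :: 'n heis) s \<subseteq> kball 0 t" using st by (auto simp: kball_def)
    have fin: "emeasure M (kball 0 s) < \<infinity>"
      using emeasure_mono[OF sub, of M] M by (auto intro: le_less_trans)
    have f0: "f z = 0" if "z \<notin> kball 0 t" for z
      using order_trans[OF indicator_pos_le f(2)[of z]] f(3)[of z] that by simp
    have fi: "integrable M f"
      by (rule integrable_continuous_compact[OF M(1) compact_kball M(2) f(1) f0])
    have "(\<integral>z. indicator (kball 0 s) z \<partial>M) \<le> (\<integral>z. f z \<partial>M)"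
      "(\<integral>z. f z \<partial>M) \<le> (\<integral>z. indicator (kball 0 t) z \<partial>M)"
      using fin M by (intro integral_mono[OF _ fi f(2)] integral_mono[OF fi _ f(3)]; simp)+
    then show ?thesis using M(1) sets_eq_imp_space_eq[OF M(1)] by simp
  qed
  have key: "measure \<nu> (kball 0 s) \<le> t ^ m \<and> s ^ m \<le> measure \<nu> (kball 0 t)" if st: "0 < s" "s < t" for s t
  proof -
    define f where "f z = max 0 (min 1 ((t - koranyi_norm z) / (t - s)))" for z :: "'n heis"
    have f: "continuous_on UNIV f"
      unfolding f_def by (intro continuous_intros) (use st in auto)
    have f1: "indicator (kball 0 s) z \<le> f z" for z
      using st by (auto simp: f_def kball_def indicator_def)
    have f2: "f z \<le> indicator (kball 0 t) z" for z
      using st by (auto simp: f_def kball_def indicator_def divide_nonpos_pos)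
    have f0: "f z = 0" if "z \<notin> kball 0 t" for z
      using order_trans[OF indicator_pos_le f1[of z]] f2[of z] that by simp
    have "{z. f z \<noteq> 0} \<subseteq> kball 0 t" using f0 by blast
    then have "compact (closure {z. f z \<noteq> 0})"
      by (meson bounded_subset compact_closure compact_imp_bounded compact_kball)
    then have conv: "(\<lambda>i. \<integral>z. f z \<partial>N i) \<longlonglongrightarrow> (\<integral>z. f z \<partial>\<nu>)"
      using lim f by (simp add: vague_limit_def)
    have Nb: "s ^ m \<le> (\<integral>z. f z \<partial>N i) \<and> (\<integral>z. f z \<partial>N i) \<le> t ^ m" for i
    proof -
      have "measure (N i) (kball 0 u) = u ^ m" if "0 < u" for u
        using N(2)[OF that, of i] that by (simp add: measure_def)
      moreover have "emeasure (N i) (kball 0 t) < \<infinity>"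
        using N(2)[of t i] st by simp
      ultimately show ?thesis
        using mono[OF N(1) _ _ f f1 f2, of i] st by simp
    qed
    have "s ^ m \<le> (\<integral>z. f z \<partial>\<nu>)" "(\<integral>z. f z \<partial>\<nu>) \<le> t ^ m"
      using LIMSEQ_le_const[OF conv] LIMSEQ_le_const2[OF conv] Nb by blast+
    then show ?thesis
      using mono[OF nu(1) nu(2)[OF compact_kball] _ f f1 f2] st by simp
  qed
  have "measure \<nu> (kball 0 r) \<le> r ^ m"
  proof (rule tendsto_lowerbound)
    show "((\<lambda>t. t ^ m) \<longlongrightarrow> r ^ m) (at_right r)"
      by (intro tendsto_intros)
    show "\<forall>\<^sub>F t in at_right r. measure \<nu> (kball 0 r) \<le> t ^ m"
      using key[OF r] by (auto simp: eventually_at_filter)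
  qed simp
  moreover have "r ^ m \<le> measure \<nu> (kball 0 r)"
  proof (rule tendsto_upperbound)
    show "((\<lambda>s. s ^ m) \<longlongrightarrow> r ^ m) (at_left r)"
      by (intro tendsto_intros)
    show "\<forall>\<^sub>F s in at_left r. s ^ m \<le> measure \<nu> (kball 0 r)"
      using key[of _ r] r by (intro eventually_at_leftI[of 0 r]) auto
  qed simp
  ultimately have "measure \<nu> (kball 0 r) = r ^ m" by simp
  then show ?thesis
    using emeasure_eq_ennreal_measure[of \<nu> "kball 0 r"] nu(2)[OF compact_kball, of 0 r] by auto
qed

text \<open>
  Left translations preserve the Koranyi distance, hence \<open>centered_spherical\<close>, and those by elements of
  \<open>vplane \<nn>\<close> preserve \<open>vplane \<nn>\<close>.  So the masses of balls at the origin determine those of all balls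
  centred on the plane.
\<close>

lemma flat_measure_uniform:
  fixes \<nn> :: "'n::finite hvec" and m :: nat
  defines "\<nu> \<equiv> centered_spherical_on m (vplane \<nn>)"
  assumes radon: "radon_measure \<nu>"
    and ball: "\<And>r. 0 < r \<Longrightarrow> emeasure \<nu> (kball 0 r) = ennreal (r ^ m)"
  shows "uniform_measure_dim m \<nu>" "msupport \<nu> = vplane \<nn>"
    and "\<And>v. v \<in> vplane \<nn> \<Longrightarrow> distr \<nu> borel (hmult v) = \<nu>"
proof -
  have sets: "sets \<nu> = sets borel" using radon by (simp add: radon_measure_def)
  have space: "space \<nu> = UNIV" using sets_eq_imp_space_eq[OF sets] by simp
  have "emeasure \<nu> (kball 0 1) \<noteq> 0" using ball[of 1] by simp
  then have val: "emeasure \<nu> A = centered_spherical m (A \<inter> vplane \<nn>)" if "A \<in> sets borel" for A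
    unfolding \<nu>_def using emeasure_centered_spherical_on that by blast
  have meas: "hmult v \<in> measurable \<nu> borel" for v
    unfolding measurable_cong_sets[OF sets refl]
    by (intro borel_measurable_continuous_onI continuous_intros)
  have inv: "distr \<nu> borel (hmult v) = \<nu>" if v: "v \<in> vplane \<nn>" for v
  proof (rule measure_eqI)
    fix A assume "A \<in> sets (distr \<nu> borel (hmult v))"
    then have A: "A \<in> sets borel" by simp
    have "hmult v -` A \<in> sets borel"
      using measurable_sets[OF meas A, of v] by (simp add: space sets)
    then have "emeasure (distr \<nu> borel (hmult v)) A = centered_spherical m (hmult v -` A \<inter> vplane \<nn>)"
      using A by (simp add: emeasure_distr[OF meas] space val)
    also have "\<dots> = centered_spherical m (hmult v ` (hmult v -` A \<inter> vplane \<nn>))"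
      by (simp add: centered_spherical_translate)
    also have "hmult v ` (hmult v -` A \<inter> vplane \<nn>) = A \<inter> vplane \<nn>"
    proof
      show "A \<inter> vplane \<nn> \<subseteq> hmult v ` (hmult v -` A \<inter> vplane \<nn>)"
      proof
        fix z assume z: "z \<in> A \<inter> vplane \<nn>"
        then have "hinv v \<star> z \<in> hmult v -` A \<inter> vplane \<nn>"
          using vplane_translate[OF v, of "hinv v \<star> z"] by simp
        then show "z \<in> hmult v ` (hmult v -` A \<inter> vplane \<nn>)"
          by (metis hmult_hinv_cancel(2) imageI)
      qed
    qed (intro image_subsetI, simp add: vplane_translate[OF v])
    finally show "emeasure (distr \<nu> borel (hmult v)) A = emeasure \<nu> A"
      using A by (simp add: val)
  qed (simp add: sets)
  then show "\<And>v. v \<in> vplane \<nn> \<Longrightarrow> distr \<nu> borel (hmult v) = \<nu>" .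
  have balls: "emeasure \<nu> (kball v r) = ennreal (r ^ m)" if v: "v \<in> vplane \<nn>" and r: "0 < r" for v r
  proof -
    have "emeasure \<nu> (kball v r) = emeasure (distr \<nu> borel (hmult v)) (kball v r)"
      by (simp add: inv[OF v])
    also have "\<dots> = emeasure \<nu> (hmult v -` kball v r)"
      by (simp add: emeasure_distr[OF meas] space)
    also have "hmult v -` kball v r = kball 0 r"
      using koranyi_dist_left_invariant[of v 0] by (auto simp: kball_def simp del: koranyi_dist_left_invariant)
    finally show ?thesis using ball[OF r] by simp
  qed
  show supp: "msupport \<nu> = vplane \<nn>"
  proof
    show "msupport \<nu> \<subseteq> vplane \<nn>"
    proof
      fix x assume x: "x \<in> msupport \<nu>"
      show "x \<in> vplane \<nn>"
      proof (rule ccontr)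
        assume "x \<notin> vplane \<nn>"
        then have "0 < emeasure \<nu> (- vplane \<nn>)"
          using x closed_vplane[of \<nn>] by (auto simp: msupport_def)
        moreover have "emeasure \<nu> (- vplane \<nn>) = 0"
          using closed_vplane[of \<nn>] by (subst val) auto
        ultimately show False by simp
      qed
    qed
    show "vplane \<nn> \<subseteq> msupport \<nu>"
    proof
      fix v assume v: "v \<in> vplane \<nn>"
      show "v \<in> msupport \<nu>"
        unfolding msupport_def
      proof (intro CollectI allI impI)
        fix U assume U: "open U \<and> v \<in> U"
        then have "\<forall>\<^sub>F r in at_right 0. kball v r \<subseteq> U \<and> 0 < r"
          by (intro eventually_conj eventually_kball_subset eventually_at_right_less) auto
        then obtain r where r: "kball v r \<subseteq> U" "0 < r"
          using eventually_happens'[OF trivial_limit_at_right_real] by blast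
        have "0 < ennreal (r ^ m)" using r(2) by simp
        also have "\<dots> \<le> emeasure \<nu> U"
          using emeasure_mono[OF r(1), of \<nu>] U by (simp add: balls[OF v r(2)] sets)
        finally show "emeasure \<nu> U > 0" .
      qed
    qed
  qed
  have "0 \<in> vplane \<nn>" by (simp add: vplane_def)
  then show "uniform_measure_dim m \<nu>"
    using radon balls by (simp add: uniform_measure_dim_def supp)
qed

section \<open>The second-order coefficient of the flat measure\<close>

text \<open>
  If the balls around two points have the same masses, then the distances to the two points have the
  same distribution, and radial integrals agree.
\<close>

lemma integral_koranyi_dist_eq:
  fixes M :: "'n::finite heis measure" and f :: "real \<Rightarrow> real"
  assumes M: "sets M = sets borel" and m: "0 < m"
    and x: "\<And>r. 0 < r \<Longrightarrow> emeasure M (kball x r) = ennreal (r ^ m)"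
    and y: "\<And>r. 0 < r \<Longrightarrow> emeasure M (kball y r) = ennreal (r ^ m)"
    and f: "f \<in> borel_measurable borel"
  shows "(\<integral>z. f (koranyi_dist x z) \<partial>M) = (\<integral>z. f (koranyi_dist y z) \<partial>M)"
proof -
  note [measurable_cong] = M
  have [measurable]: "koranyi_dist u \<in> borel_measurable M" for u
    unfolding measurable_cong_sets[OF M refl]
    by (intro borel_measurable_continuous_onI continuous_intros)
  have space: "space M = UNIV" using sets_eq_imp_space_eq[OF M] by simp
  have ball: "emeasure (distr M borel (koranyi_dist u)) {..r} = (if 0 < r then ennreal (r ^ m) else 0)"
    if u: "\<And>r. 0 < r \<Longrightarrow> emeasure M (kball u r) = ennreal (r ^ m)" for u r
  proof -
    have eq: "emeasure (distr M borel (koranyi_dist u)) {..r} = emeasure M (kball u r)"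
      by (subst emeasure_distr) (auto simp: space kball_def vimage_def)
    show ?thesis
    proof (cases "0 < r")
      case False
      have "((\<lambda>s. ennreal (s ^ m)) \<longlongrightarrow> ennreal (0 ^ m)) (at_right 0)"
        by (intro tendsto_intros)
      moreover have "\<forall>\<^sub>F s in at_right 0. emeasure M (kball u r) \<le> ennreal (s ^ m)"
        using eventually_at_right_less[of 0]
      proof eventually_elim
        case (elim s)
        have "emeasure M (kball u r) \<le> emeasure M (kball u s)"
          using False elim by (intro emeasure_mono) (auto simp: kball_def M)
        then show ?case using u[OF elim] by simp
      qed
      ultimately have "emeasure M (kball u r) \<le> ennreal (0 ^ m)"
        by (intro tendsto_lowerbound) auto
      then show ?thesis using False m eq by (simp add: zero_power)
    qed (use eq u in simp)
  qed
  have "distr M borel (koranyi_dist x) = distr M borel (koranyi_dist y)"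
  proof (rule measure_eqI_generator_eq)
    show "Int_stable (range atMost :: real set set)"
      by (auto simp: Int_stable_def)
    show "emeasure (distr M borel (koranyi_dist x)) X = emeasure (distr M borel (koranyi_dist y)) X"
      if "X \<in> range atMost" for X
      using that ball[OF x] ball[OF y] by auto
    show "(\<Union>i. {..real i}) = UNIV" using real_arch_simple by auto
    show "emeasure (distr M borel (koranyi_dist x)) {..real i} \<noteq> \<infinity>" for i
      using ball[OF x, of "real i"] by simp
  qed (auto simp: borel_eq_atMost)
  moreover have "(\<integral>z. f (koranyi_dist u z) \<partial>M) = (\<integral>t. f t \<partial>distr M borel (koranyi_dist u))" for u
    using f by (intro integral_distr[symmetric]) simp_all
  ultimately show ?thesis by simp
qed

lemma integral_bump_translate:
  fixes M :: "'n::finite heis measure"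
  assumes "sets M = sets borel" "0 < m"
    and "\<And>r. 0 < r \<Longrightarrow> emeasure M (kball y r) = ennreal (r ^ m)"
    and "\<And>r. 0 < r \<Longrightarrow> emeasure M (kball 0 r) = ennreal (r ^ m)"
  shows "(\<integral>z. bump (hinv y \<star> z) ^ 4 \<partial>M) = (\<integral>z. bump z ^ 4 \<partial>M)"
proof -
  have "bump w = max 0 (1 - koranyi_norm w ^ 4)" for w :: "'n heis"
    by (simp add: bump_def koranyi_norm_pow4)
  moreover have "(\<lambda>t::real. max 0 (1 - t ^ 4) ^ 4) \<in> borel_measurable borel"
    by (intro borel_measurable_continuous_onI continuous_intros)
  ultimately show ?thesis
    using integral_koranyi_dist_eq[OF assms, of "\<lambda>t. max 0 (1 - t ^ 4) ^ 4"]
    by (simp flip: koranyi_dist_def)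
qed

text \<open>
  If the translation by \<open>dilation (1 / R i) x\<close> does not change the integral of the test function, the
  expansion in \<open>e = 1 / R i\<close> integrates to \<open>0\<close>.  Divided by \<open>e\<^sup>2\<close>, it says that the first-order term,
  magnified by \<open>R i\<close>, is asymptotically the opposite of the second-order term.  The first-order term
  is linear in \<open>fst x\<close>.
\<close>

lemma tendsto_second_order:
  fixes N :: "nat \<Rightarrow> 'n::finite heis measure" and x :: "'n heis"
  assumes N: "\<And>i. sets (N i) = sets borel" "\<And>i. emeasure (N i) (kball 0 2) \<le> ennreal B"
    and R: "\<And>i. 0 < R i" "filterlim R at_top sequentially"
    and eq: "\<And>i. (\<integral>z. bump (hinv (dilation (1 / R i) x) \<star> z) ^ 4 \<partial>N i) = (\<integral>z. bump z ^ 4 \<partial>N i)"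
  shows "(\<lambda>i. R i * (\<integral>z. 16 * bump z ^ 3 * (fst x \<bullet> kgrad z) \<partial>N i) + (\<integral>z. second_order x z \<partial>N i))
    \<longlonglongrightarrow> 0"
proof -
  let ?K = "kball (0 :: 'n heis) 2"
  let ?I = "\<lambda>i. \<integral>z. 16 * bump z ^ 3 * (fst x \<bullet> kgrad z) \<partial>N i"
    and ?J = "\<lambda>i. \<integral>z. second_order x z \<partial>N i"
  obtain C where C: "0 \<le> C" "\<And>e z. 0 < e \<Longrightarrow> e \<le> 1 \<Longrightarrow> e * koranyi_norm x \<le> 1 \<Longrightarrow>
    \<bar>bump (hinv (dilation e x) \<star> z) ^ 4 - bump z ^ 4 - e * (16 * bump z ^ 3 * (fst x \<bullet> kgrad z))
       - e\<^sup>2 * second_order x z\<bar> \<le> C * e ^ 3 * indicator ?K z"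
    by (rule bump_translate_expansion[of x]) blast
  have fin: "emeasure (N i) ?K < \<infinity>" for i
    using N(2)[of i] by (auto intro: le_less_trans)
  have int: "integrable (N i) f" if "continuous_on UNIV f" "\<And>z. z \<notin> ?K \<Longrightarrow> f z = 0" for i and f :: "_ \<Rightarrow> real"
    by (rule integrable_continuous_compact[OF N(1) compact_kball fin that])
  have meas: "measure (N i) ?K \<le> max 0 B" for i
    using enn2real_mono[OF N(2), of i] by (cases "0 \<le> B") (auto simp: measure_def ennreal_neg)
  have inv: "((\<lambda>i. 1 / R i) \<longlongrightarrow> 0) sequentially"
    using tendsto_inverse_0_at_top[OF R(2)] by (simp add: inverse_eq_divide)
  have "\<forall>\<^sub>F i in sequentially. max 1 (koranyi_norm x) \<le> R i"
    using R(2) unfolding filterlim_at_top by blast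
  then have "\<forall>\<^sub>F i in sequentially. norm (R i * ?I i + ?J i) \<le> C * max 0 B * (1 / R i)"
  proof eventually_elim
    case (elim i)
    define e where "e = 1 / R i"
    have e: "0 < e" "e \<le> 1" "e * koranyi_norm x \<le> 1"
      using elim R(1)[of i] by (auto simp: e_def)
    have y: "koranyi_norm (dilation e x) \<le> 1"
      using e by (simp add: koranyi_norm_dilation)
    let ?f = "\<lambda>z. bump (hinv (dilation e x) \<star> z) ^ 4 - bump z ^ 4
       - e * (16 * bump z ^ 3 * (fst x \<bullet> kgrad z)) - e\<^sup>2 * second_order x z"
    have i1: "integrable (N i) (\<lambda>z. bump (hinv (dilation e x) \<star> z) ^ 4)"
      by (rule int) (intro continuous_intros, simp add: bump_translate_outside_kball[OF y])
    have i2: "integrable (N i) (\<lambda>z. bump z ^ 4)"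
      by (rule int) (intro continuous_intros, simp add: bump_outside_kball)
    have i3: "integrable (N i) (\<lambda>z. 16 * bump z ^ 3 * (fst x \<bullet> kgrad z))"
      by (rule int) (intro continuous_intros, simp add: bump_outside_kball)
    have i4: "integrable (N i) (second_order x)"
      by (rule int) (simp_all add: continuous_on_second_order second_order_outside_kball)
    have "(\<integral>z. ?f z \<partial>N i) = - (e * ?I i) - e\<^sup>2 * ?J i"
      using i1 i2 i3 i4 eq[of i] by (simp add: e_def[symmetric])
    moreover have "\<bar>\<integral>z. ?f z \<partial>N i\<bar> \<le> C * e ^ 3 * max 0 B"
    proof -
      have "\<bar>\<integral>z. ?f z \<partial>N i\<bar> \<le> (\<integral>z. C * e ^ 3 * indicator ?K z \<partial>N i)"
        using C(2)[OF e] i1 i2 i3 i4 N(1) fin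
        by (intro order_trans[OF integral_abs_bound] integral_mono) auto
      also have "\<dots> = C * e ^ 3 * measure (N i) ?K"
        using N(1)[of i] sets_eq_imp_space_eq[OF N(1), of i] by simp
      also have "\<dots> \<le> C * e ^ 3 * max 0 B"
        using meas C(1) e by (intro mult_left_mono) auto
      finally show ?thesis .
    qed
    ultimately have "\<bar>e * ?I i + e\<^sup>2 * ?J i\<bar> \<le> C * e ^ 3 * max 0 B"
      by (simp add: abs_le_iff)
    moreover have "e * ?I i + e\<^sup>2 * ?J i = e\<^sup>2 * (R i * ?I i + ?J i)"
      using R(1)[of i] by (simp add: e_def power2_eq_square field_simps)
    ultimately have "e\<^sup>2 * \<bar>R i * ?I i + ?J i\<bar> \<le> e\<^sup>2 * (C * max 0 B * e)"
      using e by (simp add: abs_mult power2_eq_square power3_eq_cube mult_ac)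
    then have "\<bar>R i * ?I i + ?J i\<bar> \<le> C * max 0 B * e"
      using e(1) by (simp only: mult_le_cancel_left_pos zero_less_power)
    then show ?case
      by (simp add: e_def)
  qed
  moreover have "(\<lambda>i. C * max 0 B * (1 / R i)) \<longlonglongrightarrow> 0"
    using tendsto_mult_right_zero[OF inv] .
  ultimately show ?thesis by (rule Lim_null_comparison)
qed

text \<open>
  Integration by parts along the centre: the integral of \<open>(G1 + z\<^sub>T G2) bump\<^sup>3\<close> does not change when
  the function is translated vertically, so its vertical derivative has integral \<open>0\<close>.
\<close>

lemma integral_vertical_derivative:
  fixes M :: "'n::finite heis measure" and G1 G2 :: "'n hvec \<Rightarrow> real"
  assumes M: "sets M = sets borel" "emeasure M (kball 0 2) < \<infinity>"
    and inv: "\<And>t. distr M borel (\<lambda>z. (fst z, snd z + t)) = M"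
    and G: "continuous_on UNIV G1" "continuous_on UNIV G2"
  shows "(\<integral>z. G2 (fst z) * bump z ^ 3
      - 6 * (bump z)\<^sup>2 * snd z * (G1 (fst z) + snd z * G2 (fst z)) \<partial>M) = 0"
proof -
  let ?K = "kball (0 :: 'n heis) 2"
  let ?s = "\<lambda>t (z :: 'n heis). (fst z, snd z + t)"
  have space: "space M = UNIV" using sets_eq_imp_space_eq[OF M(1)] by simp
  define f where "f z = (G1 (fst z) + snd z * G2 (fst z)) * bump z ^ 3" for z
  define f' where "f' z = G2 (fst z) * bump z ^ 3
      - 6 * (bump z)\<^sup>2 * snd z * (G1 (fst z) + snd z * G2 (fst z))" for z
  have Gf: "continuous_on UNIV (\<lambda>z::'n heis. G1 (fst z))" "continuous_on UNIV (\<lambda>z::'n heis. G2 (fst z))"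
    by (auto intro!: continuous_on_compose2[OF G(1)] continuous_on_compose2[OF G(2)] continuous_intros)
  have cf: "continuous_on UNIV f" and cf': "continuous_on UNIV f'"
    unfolding f_def f'_def by (intro continuous_intros Gf)+
  have int: "integrable M g" if "continuous_on UNIV g" "\<And>z. z \<notin> ?K \<Longrightarrow> g z = 0" for g :: "_ \<Rightarrow> real"
    by (rule integrable_continuous_compact[OF M(1) compact_kball M(2) that])
  obtain B1 where B1: "0 \<le> B1" "\<And>z::'n heis. z \<in> ?K \<Longrightarrow> \<bar>G1 (fst z)\<bar> \<le> B1"
    by (rule continuous_bounded_on_compact[OF compact_kball[of 0 2] Gf(1)]) blast
  obtain B2 where B2: "0 \<le> B2" "\<And>z::'n heis. z \<in> ?K \<Longrightarrow> \<bar>G2 (fst z)\<bar> \<le> B2"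
    by (rule continuous_bounded_on_compact[OF compact_kball[of 0 2] Gf(2)]) blast
  define B where "B = B1 + B2"
  have B: "0 \<le> B" "B1 \<le> B" "B2 \<le> B" using B1 B2 by (auto simp: B_def)
  \<comment> \<open>Any multiple of \<open>B\<close> by at least \<open>6 * 3159 + 3 * 9 + 3 * 5\<close>, the sum of the three error
    terms below, will do.\<close>
  define C where "C = 20000 * B"
  have s_out: "bump (?s t z) = 0" if t: "\<bar>t\<bar> \<le> 1" and z: "z \<notin> ?K" for t z
  proof -
    have "koranyi_norm (0 :: 'n hvec, - t) \<le> 1"
      using t by (simp add: koranyi_norm_le_iff kor4_def abs_square_le_1)
    moreover have "?s t z = hinv (0, - t) \<star> z"
      by (simp add: hinv_hmult)
    ultimately show ?thesis using bump_translate_outside_kball z by metis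
  qed
  have bound: "\<bar>f (?s t z) - f z - t * f' z\<bar> \<le> C * t\<^sup>2 * indicator ?K z" if t: "\<bar>t\<bar> \<le> 1" for t z
  proof (cases "z \<in> ?K")
    case False
    then show ?thesis using s_out[OF t False] by (simp add: f_def f'_def bump_outside_kball)
  next
    case True
    define A g2 G where "A = bump z" and "g2 = G2 (fst z)" and "G = G1 (fst z) + snd z * G2 (fst z)"
    define h where "h = - (2 * snd z * t + t\<^sup>2)"
    define \<rho> where "\<rho> = bump (?s t z) ^ 3 - A ^ 3 - 3 * A\<^sup>2 * h"
    have A: "0 \<le> A" "A \<le> 1" "A\<^sup>2 \<le> 1"
      using bump_le_1[of z] by (auto simp: A_def power_le_one)
    have "kor4 z \<le> 2 ^ 4"
      using True koranyi_norm_le_iff[of 2 z] by (simp add: kball_def)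
    then have "(snd z)\<^sup>2 \<le> 4\<^sup>2"
      by (simp add: kor4_def) (smt (verit) zero_le_power norm_ge_zero)
    then have "\<bar>snd z\<bar> \<le> \<bar>4\<bar>"
      by (simp only: abs_le_square_iff)
    then have zT: "\<bar>snd z\<bar> \<le> 4" by simp
    have g2: "\<bar>g2\<bar> \<le> B" using B2(2)[OF True] B by (simp add: g2_def)
    have "\<bar>snd z * G2 (fst z)\<bar> \<le> 4 * B"
      using zT g2 by (simp add: abs_mult g2_def mult_mono)
    then have Gb: "\<bar>G\<bar> \<le> 5 * B" using B1(2)[OF True] B by (simp add: G_def abs_le_iff)
    have tt: "t\<^sup>2 \<le> \<bar>t\<bar>" "t\<^sup>2 \<le> 1" using t power_decreasing[of 1 2 "\<bar>t\<bar>"] by (auto simp: abs_square_le_1)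
    have "\<bar>2 * snd z * t\<bar> \<le> 8 * \<bar>t\<bar>"
      using zT by (simp add: abs_mult mult_right_mono)
    then have hb: "\<bar>h\<bar> \<le> 9 * \<bar>t\<bar>" using tt zero_le_power2[of t] unfolding h_def by linarith
    have "1 - kor4 (?s t z) = (1 - kor4 z) + h"
      by (simp add: kor4_def h_def power2_eq_square algebra_simps)
    then have mx: "bump (?s t z) = max 0 ((1 - kor4 z) + h)"
      by (simp add: bump_def)
    have "\<bar>\<rho>\<bar> \<le> 3 * A * \<bar>h\<bar>\<^sup>2 + 4 * \<bar>h\<bar> ^ 3"
      unfolding \<rho>_def mx unfolding A_def bump_def by (rule positive_part_pow3_expansion)
    also have "\<dots> \<le> 3 * 1 * (9 * \<bar>t\<bar>)\<^sup>2 + 4 * (9 * \<bar>t\<bar>) ^ 3"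
      using A hb by (intro add_mono mult_mono power_mono) auto
    also have "\<dots> = 243 * t\<^sup>2 + 2916 * \<bar>t\<bar> ^ 3"
      by (simp add: power_mult_distrib)
    also have "\<bar>t\<bar> ^ 3 \<le> t\<^sup>2"
      using t power_decreasing[of 2 3 "\<bar>t\<bar>"] by simp
    finally have rho: "\<bar>\<rho>\<bar> \<le> 3159 * t\<^sup>2" by simp
    have "\<bar>t * g2\<bar> \<le> B"
      using t g2 mult_mono[of "\<bar>t\<bar>" 1 "\<bar>g2\<bar>" B] by (simp add: abs_mult)
    then have "\<bar>G + t * g2\<bar> \<le> 6 * B" using Gb by (simp add: abs_le_iff)
    then have e3: "\<bar>(G + t * g2) * \<rho>\<bar> \<le> 6 * B * (3159 * t\<^sup>2)"
      unfolding abs_mult using rho B by (intro mult_mono) auto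
    have e1: "\<bar>A\<^sup>2 * G * t\<^sup>2\<bar> \<le> 5 * B * t\<^sup>2"
      using A Gb B mult_mono[of "A\<^sup>2" 1 "\<bar>G\<bar>" "5 * B"] by (simp add: abs_mult mult_right_mono)
    have "\<bar>g2 * A\<^sup>2\<bar> \<le> B * 1"
      unfolding abs_mult using A g2 B by (intro mult_mono) auto
    moreover have "\<bar>t * h\<bar> \<le> 9 * t\<^sup>2"
      using mult_left_mono[OF hb, of "\<bar>t\<bar>"] by (simp add: abs_mult power2_eq_square)
    ultimately have "\<bar>g2 * A\<^sup>2\<bar> * \<bar>t * h\<bar> \<le> (B * 1) * (9 * t\<^sup>2)"
      using B by (intro mult_mono) auto
    then have e2: "\<bar>g2 * A\<^sup>2 * (t * h)\<bar> \<le> 9 * B * t\<^sup>2"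
      by (simp add: abs_mult mult_ac)
    have fz: "f z = G * A ^ 3" "f' z = g2 * A ^ 3 - 6 * A\<^sup>2 * snd z * G"
      by (simp_all add: f_def f'_def G_def g2_def A_def)
    have "f (?s t z) = (G + t * g2) * (\<rho> + A ^ 3 + 3 * A\<^sup>2 * h)"
      by (simp add: f_def G_def g2_def \<rho>_def algebra_simps)
    then have "f (?s t z) - f z - t * f' z
        = (G + t * g2) * \<rho> + 3 * (g2 * A\<^sup>2 * (t * h)) + 3 * (A\<^sup>2 * G * (h + 2 * snd z * t))"
      by (simp add: fz algebra_simps)
    also have "h + 2 * snd z * t = - t\<^sup>2" by (simp add: h_def)
    finally have "\<bar>f (?s t z) - f z - t * f' z\<bar> \<le> 6 * B * (3159 * t\<^sup>2) + 3 * (9 * B * t\<^sup>2) + 3 * (5 * B * t\<^sup>2)"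
      using e1 e2 e3 by (simp add: abs_le_iff)
    also have "\<dots> \<le> C * t\<^sup>2"
      using B(1) by (simp add: C_def)
    finally show ?thesis using True by simp
  qed
  have if': "integrable M f'" and iff: "integrable M f"
    using int[OF cf'] int[OF cf] by (auto simp: f_def f'_def bump_outside_kball)
  have "\<bar>\<integral>z. f' z \<partial>M\<bar> \<le> C * measure M ?K * t" if t: "0 < t" "t \<le> 1" for t
  proof -
    have cs: "continuous_on UNIV (\<lambda>z. f (?s t z))"
      by (rule continuous_on_compose2[OF cf]) (auto intro!: continuous_intros)
    have ish: "integrable M (\<lambda>z. f (?s t z))"
      using t by (intro int cs) (simp add: f_def s_out)
    have "(\<integral>z. f z \<partial>M) = (\<integral>z. f z \<partial>distr M borel (?s t))"
      by (simp add: inv)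
    also have "\<dots> = (\<integral>z. f (?s t z) \<partial>M)"
    proof (rule integral_distr)
      show "?s t \<in> measurable M borel"
        unfolding measurable_cong_sets[OF M(1) refl]
        by (intro borel_measurable_continuous_onI continuous_intros)
      show "f \<in> borel_measurable borel"
        using cf by (rule borel_measurable_continuous_onI)
    qed
    finally have "(\<integral>z. f (?s t z) - f z - t * f' z \<partial>M) = - (t * (\<integral>z. f' z \<partial>M))"
      using ish iff if' by simp
    moreover have "\<bar>\<integral>z. f (?s t z) - f z - t * f' z \<partial>M\<bar> \<le> (\<integral>z. C * t\<^sup>2 * indicator ?K z \<partial>M)"
      using bound[of t] t ish iff if' M
      by (intro order_trans[OF integral_abs_bound] integral_mono) auto
    moreover have "(\<integral>z. C * t\<^sup>2 * indicator ?K z \<partial>M) = C * t\<^sup>2 * measure M ?K"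
      using M by (simp add: space)
    ultimately have "t * \<bar>\<integral>z. f' z \<partial>M\<bar> \<le> t * (C * measure M ?K * t)"
      using t by (simp add: abs_mult power2_eq_square mult_ac space)
    then show ?thesis using t by simp
  qed
  then have "\<forall>\<^sub>F t in at_right 0. \<bar>\<integral>z. f' z \<partial>M\<bar> \<le> C * measure M ?K * t"
    by (intro eventually_at_rightI[of 0 1]) auto
  moreover have "((\<lambda>t. C * measure M ?K * t) \<longlongrightarrow> C * measure M ?K * 0) (at_right 0)"
    by (intro tendsto_intros)
  ultimately have "\<bar>\<integral>z. f' z \<partial>M\<bar> \<le> C * measure M ?K * 0"
    by (intro tendsto_lowerbound) auto
  then show ?thesis by (simp add: f'_def)
qed

text \<open>
  Write \<open>fst x = a *\<^sub>R \<nn> + u\<close> with \<open>u\<close> orthogonal to \<open>\<nn>\<close>.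

  For \<open>v\<close> in the plane the integral vanishes: by translation invariance the expansion can be
  applied to the constant sequence \<open>\<nu>\<close> at \<open>v\<close> and at the point with horizontal part \<open>- fst v\<close> and the
  same vertical part.  The two first-order terms cancel and the second-order terms are equal.

  On the plane \<open>\<nn> \<bullet> z\<^sub>H = 0\<close>, so \<open>\<nn>\<close> meets \<open>kgrad z\<close> only through \<open>z\<^sub>T J z\<^sub>H\<close>.  The terms containing
  \<open>a\<close> are then vertical derivatives, with integral \<open>0\<close>, except for the one that comes from
  \<open>(norm (fst x))\<^sup>2\<close>.
\<close>

lemma integral_second_order_flat:
  fixes \<nu> :: "'n::finite heis measure" and \<nn> :: "'n hvec"
  assumes nu: "uniform_measure_dim m \<nu>" "0 < m" and supp: "msupport \<nu> = vplane \<nn>" and n: "norm \<nn> = 1"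
    and inv: "\<And>v. v \<in> vplane \<nn> \<Longrightarrow> distr \<nu> borel (hmult v) = \<nu>"
  shows "(\<integral>z. second_order x z \<partial>\<nu>)
    = - ((\<nn> \<bullet> fst x)\<^sup>2 * (8 * (\<integral>z. bump z ^ 3 * (norm (fst z))\<^sup>2 \<partial>\<nu>)))"
proof -
  note nu' = uniform_measure_dimD[OF nu(1)]
  let ?K = "kball (0 :: 'n heis) 2"
  have fin: "emeasure \<nu> ?K < \<infinity>" using nu'(5) by simp
  have int: "integrable \<nu> f" if "continuous_on UNIV f" "\<And>z. z \<notin> ?K \<Longrightarrow> f z = 0" for f :: "_ \<Rightarrow> real"
    by (rule integrable_continuous_compact[OF nu'(1) compact_kball fin that])
  let ?I = "\<lambda>v. \<integral>z. 16 * bump z ^ 3 * (fst v \<bullet> kgrad z) \<partial>\<nu>"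
    and ?J = "\<lambda>v. \<integral>z. second_order v z \<partial>\<nu>"
  have conv: "(\<lambda>i. real (Suc i) * ?I v + ?J v) \<longlonglongrightarrow> 0" if v: "v \<in> vplane \<nn>" for v
  proof (rule tendsto_second_order)
    show "emeasure \<nu> ?K \<le> ennreal (measure \<nu> ?K)" for i :: nat
      using fin by (simp add: emeasure_eq_ennreal_measure)
    show "filterlim (\<lambda>i. real (Suc i)) at_top sequentially"
      by (rule filterlim_compose[OF filterlim_real_sequentially filterlim_Suc])
    show "(\<integral>z. bump (hinv (dilation (1 / real (Suc i)) v) \<star> z) ^ 4 \<partial>\<nu>) = (\<integral>z. bump z ^ 4 \<partial>\<nu>)" for i
    proof (rule integral_bump_translate[OF nu'(1) nu(2)])
      have "dilation (1 / real (Suc i)) v \<in> vplane \<nn>"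
        using v by (simp add: vplane_def dilation_def)
      then show "emeasure \<nu> (kball (dilation (1 / real (Suc i)) v) r) = ennreal (r ^ m)" if "0 < r" for r
        using nu'(4) supp that by blast
    qed (use nu' in auto)
  qed (use nu' in auto)
  have plane: "?J v = 0" if v: "v \<in> vplane \<nn>" for v
  proof -
    let ?w = "(- fst v, snd v)"
    have w: "?w \<in> vplane \<nn>" using v by (simp add: vplane_def)
    have J: "second_order ?w = second_order v"
      by (rule ext) (simp add: second_order_def kquad_def power2_eq_square)
    have "?I ?w = - ?I v" by simp
    then have "(\<lambda>i::nat. 2 * ?J v) \<longlonglongrightarrow> 0 + 0"
      using tendsto_add[OF conv[OF v] conv[OF w]] by (simp add: J)
    then show ?thesis by (simp add: LIMSEQ_const_iff)
  qed
  define a where "a = \<nn> \<bullet> fst x"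
  define u where "u = fst x - a *\<^sub>R \<nn>"
  have nn: "\<nn> \<bullet> \<nn> = 1" using n by (simp add: norm_eq_1)
  have nu0: "\<nn> \<bullet> u = 0" by (simp add: u_def a_def inner_diff_right nn)
  have fx: "fst x = a *\<^sub>R \<nn> + u" by (simp add: u_def)
  \<comment> \<open>\<open>G1\<close> collects the terms with one factor \<open>z\<^sub>T\<close>, and \<open>G2\<close> those with two or none.\<close>
  define G1 where "G1 w = 2 * a * (\<nn> \<bullet> sympJ w) * (u \<bullet> w) * (norm w)\<^sup>2" for w
  define G2 where "G2 w = a\<^sup>2 * (\<nn> \<bullet> sympJ w)\<^sup>2 + 2 * a * (\<nn> \<bullet> sympJ w) * (u \<bullet> sympJ w)" for w
  define f' where "f' z = G2 (fst z) * bump z ^ 3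
      - 6 * (bump z)\<^sup>2 * snd z * (G1 (fst z) + snd z * G2 (fst z))" for z
  have G: "continuous_on UNIV G1" "continuous_on UNIV G2"
    unfolding G1_def G2_def by (intro continuous_intros)+
  have vert: "(\<integral>z. f' z \<partial>\<nu>) = 0"
    unfolding f'_def
  proof (rule integral_vertical_derivative[OF nu'(1) fin _ G])
    fix t
    have "(0, t) \<in> vplane \<nn>" by (simp add: vplane_def)
    moreover have "hmult (0, t) = (\<lambda>z :: 'n heis. (fst z, snd z + t))"
      by (auto simp: hmult_def)
    ultimately show "distr \<nu> borel (\<lambda>z. (fst z, snd z + t)) = \<nu>" using inv by metis
  qed
  have if': "integrable \<nu> f'"
    by (rule int; unfold f'_def G1_def G2_def; (intro continuous_intros)?; simp add: bump_outside_kball)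
  have ib: "integrable \<nu> (\<lambda>z. bump z ^ 3 * (norm (fst z))\<^sup>2)"
    by (rule int) (intro continuous_intros, simp add: bump_outside_kball)
  have ish: "integrable \<nu> (second_order v)" for v
    by (rule int) (simp_all add: continuous_on_second_order second_order_outside_kball)
  have nx: "(norm (fst x))\<^sup>2 = a\<^sup>2 + (norm u)\<^sup>2"
    unfolding fx power2_norm_eq_inner
    by (simp add: inner_add_left inner_add_right nn nu0 inner_commute[of u \<nn>] power2_eq_square)
  have "AE z in \<nu>. second_order x z
      = second_order (u, snd x) z - 8 * a\<^sup>2 * (bump z ^ 3 * (norm (fst z))\<^sup>2) - 16 * f' z"
    using AE_msupport[OF nu'(1)]
  proof eventually_elim
    case (elim z)
    then have z: "\<nn> \<bullet> fst z = 0" by (simp add: supp vplane_def)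
    have xz: "fst x \<bullet> fst z = u \<bullet> fst z"
      "fst x \<bullet> sympJ (fst z) = a * (\<nn> \<bullet> sympJ (fst z)) + u \<bullet> sympJ (fst z)"
      by (simp_all add: fx inner_add_left z)
    show ?case
      unfolding second_order_def kquad_def kgrad_def nx f'_def G1_def G2_def
      by (simp add: inner_add_right xz) algebra
  qed
  then have "?J x = (\<integral>z. second_order (u, snd x) z
      - 8 * a\<^sup>2 * (bump z ^ 3 * (norm (fst z))\<^sup>2) - 16 * f' z \<partial>\<nu>)"
    using ish if' ib
    by (intro integral_cong_AE) (auto intro!: borel_measurable_integrable)
  also have "\<dots> = ?J (u, snd x) - 8 * a\<^sup>2 * (\<integral>z. bump z ^ 3 * (norm (fst z))\<^sup>2 \<partial>\<nu>) - 16 * (\<integral>z. f' z \<partial>\<nu>)"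
    using ish if' ib by simp
  also have "?J (u, snd x) = 0"
    by (rule plane) (simp add: vplane_def nu0)
  finally show ?thesis by (simp add: vert a_def)
qed

section \<open>Flatness at infinity confines the support to two parallel planes\<close>

text \<open>
  Convergence on a set passes to its linear span, where the
  limit is linear, and a linear function on a subspace extends to the whole space.
\<close>

lemma linear_pointwise_limit:
  fixes L :: "nat \<Rightarrow> 'a::real_vector \<Rightarrow> real"
  assumes lin: "\<And>i. linear (L i)" and lim: "\<And>x. x \<in> S \<Longrightarrow> (\<lambda>i. L i x) \<longlonglongrightarrow> l x"
  obtains g where "linear g" "\<And>x. x \<in> S \<Longrightarrow> g x = l x"
proof -
  obtain B where B: "B \<subseteq> S" "independent B" "S \<subseteq> span B"
    using maximal_independent_subset[of S] by blast
  obtain g where g: "linear g" "\<forall>x \<in> B. g x = l x"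
    using linear_independent_extend[OF B(2), of l] by blast
  have "(\<lambda>i. L i x) \<longlonglongrightarrow> g x" if "x \<in> span B" for x
    using that
  proof (induction rule: span_induct_alt)
    case base
    then show ?case by (simp add: linear_0[OF lin] linear_0[OF g(1)])
  next
    case (step c x y)
    have "(\<lambda>i. L i x) \<longlonglongrightarrow> g x" using step(1) g(2) lim B(1) by auto
    then have "(\<lambda>i. c * L i x + L i y) \<longlonglongrightarrow> c * g x + g y"
      using step.IH by (intro tendsto_intros)
    then show ?case
      by (simp add: linear_add[OF lin] linear_add[OF g(1)] linear_cmul[OF lin] linear_cmul[OF g(1)])
  qed
  then have "g x = l x" if "x \<in> S" for x
    using that B(3) lim[OF that] LIMSEQ_unique by blast
  with g(1) show thesis by (rule that)
qed

lemma sets_blowdown: "sets (scale_measure c (rescale \<mu> R)) = sets borel"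
  by (simp add: rescale_def)

lemma blowdown_kball:
  assumes mu: "uniform_measure_dim m \<mu>" and x: "x \<in> msupport \<mu>" and R: "0 < R" and r: "0 < r"
  shows "emeasure (scale_measure (ennreal (1 / R ^ m)) (rescale \<mu> R)) (kball (dilation (1 / R) x) r)
    = ennreal (r ^ m)"
proof -
  note mu' = uniform_measure_dimD[OF mu]
  have "emeasure (rescale \<mu> R) (kball (dilation (1 / R) x) r) = ennreal ((R * r) ^ m)"
    using mu'(4)[OF x, of "R * r"] R r
    by (simp add: emeasure_rescale[OF mu'(1) R] dilation_kball)
  then show ?thesis
    using R r by (simp add: power_mult_distrib flip: ennreal_mult)
qed

text \<open>
  At a support point \<open>x\<close> of \<open>\<mu>\<close> the magnified first-order terms of the blow-downs converge, because the
  second-order terms converge by vague convergence.  Being linear in \<open>fst x\<close>, they leave a linear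
  functional in the limit, which on the support coincides with a quadratic form of rank one.
\<close>

lemma limit_functional:
  fixes \<mu> :: "'n::finite heis measure" and \<nn> :: "'n hvec"
  assumes mu: "uniform_measure_dim m \<mu>" "0 < m" and n: "norm \<nn> = 1"
    and R: "\<And>i. 0 < R i" "filterlim R at_top sequentially"
    and lim: "vague_limit (\<lambda>i. scale_measure (ennreal (1 / R i ^ m)) (rescale \<mu> (R i))) \<nu>"
    and nu: "uniform_measure_dim m \<nu>" and supp: "msupport \<nu> = vplane \<nn>"
    and inv: "\<And>v. v \<in> vplane \<nn> \<Longrightarrow> distr \<nu> borel (hmult v) = \<nu>"
  obtains g k where "linear g" "0 < k" "\<And>x. x \<in> msupport \<mu> \<Longrightarrow> g (fst x) = k * (\<nn> \<bullet> fst x)\<^sup>2"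
proof -
  note mu' = uniform_measure_dimD[OF mu(1)] and nu' = uniform_measure_dimD[OF nu]
  define N where "N i = scale_measure (ennreal (1 / R i ^ m)) (rescale \<mu> (R i))" for i
  have N: "sets (N i) = sets borel" for i by (simp only: N_def sets_blowdown)
  have Nball: "emeasure (N i) (kball (dilation (1 / R i) x) r) = ennreal (r ^ m)"
    if "x \<in> msupport \<mu>" "0 < r" for i x r
    unfolding N_def using blowdown_kball[OF mu(1) that(1) R(1) that(2)] .
  have Nball0: "emeasure (N i) (kball 0 r) = ennreal (r ^ m)" if "0 < r" for i r
    using Nball[OF mu'(3) that, of i] by (simp add: dilation_def zero_prod_def)
  have int: "integrable (N i) f" if "continuous_on UNIV f" "\<And>z. z \<notin> kball 0 2 \<Longrightarrow> f z = 0" for f :: "_ \<Rightarrow> real" and i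
    using Nball0[of 2 i] by (intro integrable_continuous_compact[OF N compact_kball _ that]) auto
  define k where "k = 8 * (\<integral>z. bump z ^ 3 * (norm (fst z))\<^sup>2 \<partial>\<nu>)"
  define L where "L i h = R i * (\<integral>z. 16 * bump z ^ 3 * (h \<bullet> kgrad z) \<partial>N i)" for i h
  have k: "0 < k"
  proof -
    \<comment> \<open>A point of the plane inside the unit ball, with nonzero horizontal part.\<close>
    let ?z = "((1 / 2) *\<^sub>R sympJ \<nn>, 0 :: real)"
    have "0 < (\<integral>z. bump z ^ 3 * (norm (fst z))\<^sup>2 \<partial>\<nu>)"
    proof (rule integral_pos_msupport[OF nu'(1) compact_kball[of 0 2]])
      show "continuous_on UNIV (\<lambda>z::'n heis. bump z ^ 3 * (norm (fst z))\<^sup>2)"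
        by (intro continuous_intros)
      show "?z \<in> msupport \<nu>"
        by (simp add: supp vplane_def)
      have "bump ?z = 15 / 16"
        using n by (simp add: bump_def kor4_def power_divide)
      then show "0 < bump ?z ^ 3 * (norm (fst ?z))\<^sup>2"
        using n by simp
    qed (use nu' in \<open>auto simp: bump_outside_kball\<close>)
    then show ?thesis by (simp add: k_def)
  qed
  have L_int: "integrable (N i) (\<lambda>z. 16 * bump z ^ 3 * (h \<bullet> kgrad z))" for i h
    by (rule int) (intro continuous_intros, simp add: bump_outside_kball)
  have L_lin: "linear (L i)" for i
  proof (rule linearI)
    show "L i (h + h') = L i h + L i h'" for h h'
      using L_int[of i h] L_int[of i h'] by (simp add: L_def inner_add_left distrib_left)
    show "L i (c *\<^sub>R h) = c *\<^sub>R L i h" for c h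
    proof -
      have "(\<integral>z. 16 * bump z ^ 3 * (c *\<^sub>R h \<bullet> kgrad z) \<partial>N i)
          = (\<integral>z. c * (16 * bump z ^ 3 * (h \<bullet> kgrad z)) \<partial>N i)"
        by (simp add: mult_ac)
      then show ?thesis by (simp only: L_def Bochner_Integration.integral_mult_right_zero) simp
    qed
  qed
  have L_lim: "(\<lambda>i. L i (fst x)) \<longlonglongrightarrow> k * (\<nn> \<bullet> fst x)\<^sup>2" if x: "x \<in> msupport \<mu>" for x
  proof -
    have "(\<lambda>i. L i (fst x) + (\<integral>z. second_order x z \<partial>N i)) \<longlonglongrightarrow> 0"
      unfolding L_def
    proof (rule tendsto_second_order[OF N _ R])
      show "emeasure (N i) (kball 0 2) \<le> ennreal (2 ^ m)" for i
        by (simp add: Nball0)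
      show "(\<integral>z. bump (hinv (dilation (1 / R i) x) \<star> z) ^ 4 \<partial>N i) = (\<integral>z. bump z ^ 4 \<partial>N i)" for i
        by (rule integral_bump_translate[OF N mu(2) Nball[OF x] Nball0])
    qed
    moreover have "(\<lambda>i. \<integral>z. second_order x z \<partial>N i) \<longlonglongrightarrow> (\<integral>z. second_order x z \<partial>\<nu>)"
    proof -
      have "{z. second_order x z \<noteq> 0} \<subseteq> kball 0 2"
        using second_order_outside_kball by blast
      then have "compact (closure {z. second_order x z \<noteq> 0})"
        by (meson bounded_subset compact_closure compact_imp_bounded compact_kball)
      then show ?thesis
        using lim continuous_on_second_order[of UNIV x] unfolding vague_limit_def N_def by blast
    qed
    ultimately have "(\<lambda>i. (L i (fst x) + (\<integral>z. second_order x z \<partial>N i)) - (\<integral>z. second_order x z \<partial>N i))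
        \<longlonglongrightarrow> 0 - (\<integral>z. second_order x z \<partial>\<nu>)"
      by (rule tendsto_diff)
    then show ?thesis
      using integral_second_order_flat[OF nu mu(2) supp n inv, of x] by (simp add: k_def mult_ac)
  qed
  obtain g where g: "linear g" "\<And>h. h \<in> fst ` msupport \<mu> \<Longrightarrow> g h = k * (\<nn> \<bullet> h)\<^sup>2"
    by (rule linear_pointwise_limit[OF L_lin, where S = "fst ` msupport \<mu>" and l = "\<lambda>h. k * (\<nn> \<bullet> h)\<^sup>2"])
      (use L_lim in auto)
  show thesis
    by (rule that[OF g(1) k]) (use g(2) in auto)
qed

text \<open>
  The half-space on which a linear functional of the horizontal part is negative is open and invariant
  under dilations.  If it misses the support of \<open>\<mu>\<close>, it is null for all rescalings of \<open>\<mu>\<close>, and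
  then it contains no support point of a vague limit.
\<close>

lemma support_functional_nonneg_on_blowdown:
  fixes \<mu> :: "'n::finite heis measure"
  assumes mu: "sets \<mu> = sets borel" and R: "\<And>i. 0 < R i"
    and lim: "vague_limit (\<lambda>i. scale_measure (c i) (rescale \<mu> (R i))) \<nu>"
    and nu: "sets \<nu> = sets borel" "\<And>K. compact K \<Longrightarrow> emeasure \<nu> K < \<infinity>"
    and g: "linear g" "\<And>x. x \<in> msupport \<mu> \<Longrightarrow> (0::real) \<le> g (fst x)"
    and v: "v \<in> msupport \<nu>"
  shows "0 \<le> g (fst v)"
proof (rule ccontr)
  assume neg: "\<not> 0 \<le> g (fst v)"
  let ?r = "koranyi_norm v + 1"
  define f where "f z = max 0 (- g (fst z)) * max 0 (?r - koranyi_norm z)" for z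
  have cg: "continuous_on UNIV (\<lambda>z::'n heis. g (fst z))"
    by (intro linear_continuous_on_compose[OF continuous_on_fst[OF continuous_on_id] g(1)])
  then have cf: "continuous_on UNIV f"
    unfolding f_def by (intro continuous_intros)
  have f0: "f z = 0" if "z \<notin> kball 0 ?r" for z
    using that by (simp add: f_def kball_def)
  have "0 < (\<integral>z. f z \<partial>\<nu>)"
    by (rule integral_pos_msupport[OF nu(1) compact_kball nu(2)[OF compact_kball] cf f0 _ v])
      (use neg in \<open>auto simp: f_def\<close>)
  moreover have "{z. f z \<noteq> 0} \<subseteq> kball 0 ?r" using f0 by blast
  then have "compact (closure {z. f z \<noteq> 0})"
    by (meson bounded_subset compact_closure compact_imp_bounded compact_kball)
  then have "(\<lambda>i. \<integral>z. f z \<partial>scale_measure (c i) (rescale \<mu> (R i))) \<longlonglongrightarrow> (\<integral>z. f z \<partial>\<nu>)"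
    using lim cf by (simp add: vague_limit_def)
  moreover have "(\<integral>z. f z \<partial>scale_measure (c i) (rescale \<mu> (R i))) = 0" for i
  proof -
    let ?U = "{z :: 'n heis. g (fst z) < 0}"
    have U: "?U \<in> sets borel"
      using cg by (intro borel_open open_Collect_less continuous_intros)
    have "dilation (R i) ` ?U \<inter> msupport \<mu> = {}"
    proof -
      have neg_dil: "g (fst (dilation (R i) z)) < 0" if "g (fst z) < 0" for z :: "'n heis"
        using R[of i] that by (simp add: dilation_def linear_cmul[OF g(1)] mult_pos_neg)
      have "dilation (R i) z \<notin> msupport \<mu>" if "g (fst z) < 0" for z :: "'n heis"
        using neg_dil[OF that] g(2)[of "dilation (R i) z"] by linarith
      then show ?thesis by blast
    qed
    then have "emeasure (rescale \<mu> (R i)) ?U = 0"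
      using emeasure_disjoint_msupport[OF mu] by (simp add: emeasure_rescale[OF mu R U])
    then have "AE z in scale_measure (c i) (rescale \<mu> (R i)). z \<notin> ?U"
      using U by (intro AE_I[of _ _ ?U]) (auto simp: rescale_def)
    then have "AE z in scale_measure (c i) (rescale \<mu> (R i)). f z = 0"
      by eventually_elim (simp add: f_def)
    then show ?thesis by (rule integral_eq_zero_AE)
  qed
  ultimately show False by (simp add: LIMSEQ_const_iff)
qed

text \<open>
  The functional \<open>g\<close> of \<open>limit_functional\<close> is nonnegative on the support of \<open>\<mu>\<close>, hence on the
  hyperplane orthogonal to \<open>\<nn>\<close>, hence zero there.  So \<open>g\<close> is a multiple of \<open>h \<mapsto> \<nn> \<bullet> h\<close>, and
  on the support \<open>g = k * (\<nn> \<bullet> _)\<^sup>2\<close> is a quadratic equation for \<open>\<nn> \<bullet> fst x\<close>, one of whose roots is \<open>0\<close>.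
\<close>

lemma blowdown_flat_support:
  fixes \<mu> :: "'n::finite heis measure" and \<nn> :: "'n hvec"
  assumes mu: "uniform_measure_dim m \<mu>" "0 < m" and n: "norm \<nn> = 1"
    and R: "\<And>i. 0 < R i" "filterlim R at_top sequentially"
    and lim: "vague_limit (\<lambda>i. scale_measure (ennreal (1 / R i ^ m)) (rescale \<mu> (R i))) \<nu>"
    and nu: "uniform_measure_dim m \<nu>" and supp: "msupport \<nu> = vplane \<nn>"
    and inv: "\<And>v. v \<in> vplane \<nn> \<Longrightarrow> distr \<nu> borel (hmult v) = \<nu>"
  obtains c where "\<And>x. x \<in> msupport \<mu> \<Longrightarrow> \<nn> \<bullet> fst x = 0 \<or> \<nn> \<bullet> fst x = c"
proof -
  obtain g k where g: "linear g" "0 < k" "\<And>x. x \<in> msupport \<mu> \<Longrightarrow> g (fst x) = k * (\<nn> \<bullet> fst x)\<^sup>2"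
    using limit_functional[OF assms] by blast
  have nonneg: "0 \<le> g h" if "\<nn> \<bullet> h = 0" for h
    using support_functional_nonneg_on_blowdown[OF uniform_measure_dimD(1)[OF mu(1)] R(1) lim
        uniform_measure_dimD(1,5)[OF nu] g(1), of "(h, 0)"] g(2,3) that
    by (simp add: supp vplane_def)
  have zero: "g h = 0" if "\<nn> \<bullet> h = 0" for h
    using nonneg[of h] nonneg[of "- h"] that by (simp add: linear_neg[OF g(1)])
  have nn: "\<nn> \<bullet> \<nn> = 1" using n by (simp add: norm_eq_1)
  have gh: "g h = (\<nn> \<bullet> h) * g \<nn>" for h
    using zero[of "h - (\<nn> \<bullet> h) *\<^sub>R \<nn>"]
    by (simp add: inner_diff_right nn linear_diff[OF g(1)] linear_cmul[OF g(1)])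
  show thesis
  proof (rule that)
    fix x assume "x \<in> msupport \<mu>"
    then have "k * (\<nn> \<bullet> fst x)\<^sup>2 = (\<nn> \<bullet> fst x) * g \<nn>"
      using g(3)[of x] gh[of "fst x"] by simp
    then show "\<nn> \<bullet> fst x = 0 \<or> \<nn> \<bullet> fst x = g \<nn> / k"
      using g(2) by (auto simp: power2_eq_square field_simps)
  qed
qed

section \<open>Uniform measures on two parallel planes\<close>

lemma bounded_koranyi_ball: "bounded {z. koranyi_dist (x :: 'n::finite heis) z < r}"
  by (rule bounded_subset[OF compact_imp_bounded[OF compact_kball[of x r]]]) (auto simp: kball_def)

lemma connected_vplane: "connected (vplane \<nn>)"
proof -
  have "vplane \<nn> = {z. (\<nn>, 0) \<bullet> z = 0}"
    by (auto simp: vplane_def inner_prod_def)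
  then show ?thesis by (simp add: convex_hyperplane convex_connected)
qed

text \<open>
  Near the plane through the origin, \<open>\<mu>\<close> is the restriction of \<open>\<nu>\<close> to its support.  As small balls
  around common points have the same mass for both measures, the support of \<open>\<mu>\<close> meets the plane
  in a relatively open set.  This set is also closed and contains \<open>0\<close>, and the plane is connected, so
  the support contains the plane.  The plane alone then carries the full mass \<open>r ^ m\<close> of
  every ball around the origin, which leaves nothing for the second plane.
\<close>

lemma uniform_measure_eq_flat:
  fixes \<mu> :: "'n::finite heis measure" and \<nn> :: "'n hvec"
  assumes mu: "uniform_measure_dim m \<mu>" and nu: "uniform_measure_dim m \<nu>" "msupport \<nu> = vplane \<nn>"
    and planes: "\<And>x. x \<in> msupport \<mu> \<Longrightarrow> \<nn> \<bullet> fst x = 0 \<or> \<nn> \<bullet> fst x = c"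
  shows "\<mu> = \<nu>"
proof -
  note mu' = uniform_measure_dimD[OF mu] and nu' = uniform_measure_dimD[OF nu(1)]
  let ?S = "msupport \<mu>" and ?V = "vplane \<nn>"
  \<comment> \<open>The slab \<open>W\<close> meets only the first plane, and the second plane, if it is a different one, lies in
    the interior of the complement of \<open>W\<close>.\<close>
  define \<delta> where "\<delta> = (if c = 0 then 1 else \<bar>c\<bar> / 2)"
  define W where "W = {z :: 'n heis. \<bar>\<nn> \<bullet> fst z\<bar> < \<delta>}"
  have \<delta>: "0 < \<delta>" by (simp add: \<delta>_def)
  have W: "open W" unfolding W_def by (intro open_Collect_less continuous_intros)
  have VW: "?V \<subseteq> W" using \<delta> by (auto simp: W_def vplane_def)
  have SW: "?S \<inter> W \<subseteq> ?V"
    using planes by (fastforce simp: W_def vplane_def \<delta>_def split: if_splits)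
  have local: "emeasure \<mu> U = emeasure \<nu> (U \<inter> ?S)" if "open U" "bounded U" "U \<subseteq> W" for U
    using SW that nu(2) by (intro uniform_measure_eq_restricted[OF mu nu(1)]) auto
  have V0: "0 \<in> ?V" by (simp add: vplane_def)
  have nbhd: "\<exists>T. open T \<and> x \<in> T \<and> T \<inter> ?V \<subseteq> ?S" if x: "x \<in> ?S" "x \<in> ?V" for x
  proof -
    have "\<forall>\<^sub>F r in at_right 0. kball x r \<subseteq> W \<and> 0 < r"
      using x(2) VW W
      by (intro eventually_conj eventually_kball_subset eventually_at_right_less) auto
    then obtain r where r: "kball x r \<subseteq> W" "0 < r"
      using eventually_happens'[OF trivial_limit_at_right_real] by blast
    define T where "T = {z. koranyi_dist x z < r}"
    have T: "open T" "bounded T" "T \<subseteq> W"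
      using open_koranyi_ball[of x r] bounded_koranyi_ball[of x r] r(1) by (auto simp: T_def kball_def)
    have "emeasure \<nu> (T \<inter> ?S) = emeasure \<nu> T"
      using local[OF T] uniform_measure_open_ball[OF mu x(1) r(2)]
        uniform_measure_open_ball[OF nu(1) _ r(2), of x] x(2) nu(2) by (simp add: T_def)
    moreover have "emeasure \<nu> T = emeasure \<nu> (T \<inter> ?S) + emeasure \<nu> (T - ?S)"
      using T(1) nu'(1) by (subst plus_emeasure) (auto simp: Int_Diff_Un)
    moreover have "emeasure \<nu> T < \<infinity>"
      by (rule emeasure_bounded_finite[OF nu'(1,5) T(2)])
    ultimately have null: "emeasure \<nu> (T - ?S) = 0"
      by (metis add.right_neutral ennreal_add_left_cancel infinity_ennreal_def order_less_irrefl)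
    have "T \<inter> ?V \<subseteq> ?S"
    proof
      fix v assume v: "v \<in> T \<inter> ?V"
      show "v \<in> ?S"
      proof (rule ccontr)
        assume "v \<notin> ?S"
        moreover have "open (T - ?S)" using T(1) closed_msupport by (rule open_Diff)
        ultimately have "0 < emeasure \<nu> (T - ?S)"
          using v nu(2) unfolding msupport_def[of \<nu>] by blast
        then show False using null by simp
      qed
    qed
    then show ?thesis using T(1) r(2) by (intro exI[of _ T]) (simp add: T_def)
  qed
  have VS: "?V \<subseteq> ?S"
  proof -
    let ?O = "\<Union>{T. open T \<and> T \<inter> ?V \<subseteq> ?S}"
    have "?O \<inter> - ?S \<inter> ?V = {}" by auto
    moreover have "?V \<subseteq> ?O \<union> - ?S" using nbhd by blast
    moreover have "open ?O" by auto
    ultimately have "?O \<inter> ?V = {} \<or> - ?S \<inter> ?V = {}"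
      by (intro connectedD[OF connected_vplane _ open_compl_msupport])
    moreover have "0 \<in> ?O" using nbhd[OF mu'(3) V0] by blast
    ultimately show ?thesis using V0 by blast
  qed
  have SV: "?S \<subseteq> ?V"
  proof
    fix x assume x: "x \<in> ?S"
    show "x \<in> ?V"
    proof (rule ccontr)
      assume "x \<notin> ?V"
      then have c: "\<nn> \<bullet> fst x = c" "c \<noteq> 0" using planes[OF x] by (auto simp: vplane_def)
      define r where "r = koranyi_norm x + 1"
      have r: "0 < r" using koranyi_norm_nonneg[of x] unfolding r_def by linarith
      define U where "U = {z :: 'n heis. koranyi_dist 0 z < r}"
      define U'' where "U'' = U \<inter> {z. \<delta> < \<bar>\<nn> \<bullet> fst z\<bar>}"
      have U: "open U" "bounded U"
        using open_koranyi_ball[of 0 r] bounded_koranyi_ball[of 0 r] by (simp_all only: U_def)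
      have mU: "emeasure \<mu> U = ennreal (r ^ m)" "emeasure \<nu> U = ennreal (r ^ m)"
        using uniform_measure_open_ball[OF mu mu'(3) r] uniform_measure_open_ball[OF nu(1) nu'(3) r]
        by (simp_all add: U_def)
      have U'': "open U''" unfolding U''_def
        by (intro open_Int U open_Collect_less continuous_intros)
      have xU: "x \<in> U''" using c by (simp add: U''_def U_def r_def \<delta>_def)
      have pos: "0 < emeasure \<mu> U''" using x xU U'' by (auto simp: msupport_def)
      have "emeasure \<nu> U = emeasure \<nu> (U \<inter> ?V)"
        using U nu'(1) AE_msupport[OF nu'(1)] closed_vplane[of \<nn>] nu(2)
        by (intro emeasure_eq_AE) auto
      also have "\<dots> \<le> emeasure \<nu> (U \<inter> W \<inter> ?S)"
        using VW VS U W nu'(1) by (intro emeasure_mono) auto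
      also have "\<dots> = emeasure \<mu> (U \<inter> W)"
        using U W by (intro local[symmetric]) (auto intro: bounded_subset)
      finally have "ennreal (r ^ m) \<le> emeasure \<mu> (U \<inter> W)" using mU by simp
      then have "ennreal (r ^ m) + emeasure \<mu> U'' \<le> emeasure \<mu> (U \<inter> W) + emeasure \<mu> U''"
        by (rule add_right_mono)
      also have "\<dots> = emeasure \<mu> ((U \<inter> W) \<union> U'')"
        using U W U'' mu'(1) by (intro plus_emeasure) (auto simp: W_def U''_def)
      also have "\<dots> \<le> ennreal (r ^ m) + 0"
        using emeasure_mono[of "(U \<inter> W) \<union> U''" U \<mu>] U mu'(1) mU by (auto simp: U''_def)
      finally have "emeasure \<mu> U'' \<le> 0"
        by (simp only: ennreal_add_left_cancel_le) simp
      then show False using pos by simp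
    qed
  qed
  show ?thesis
    by (rule uniform_measure_eqI[OF mu nu(1)]) (use SV VS nu(2) in auto)
qed

theorem theorem5p9:
  fixes \<mu> :: "'n::finite heis measure" and \<nn> :: "'n hvec"
  assumes "uniform_measure_dim (2 * CARD('n) + 1) \<mu>"
    and "\<nn> \<in> sphere 0 1"
    and "centered_spherical_on (2 * CARD('n) + 1) (vplane \<nn>) \<in> Tan_infinity (2 * CARD('n) + 1) \<mu>"
  shows "\<mu> = centered_spherical_on (2 * CARD('n) + 1) (vplane \<nn>)"
proof -
  define m where "m = 2 * CARD('n) + 1"
  define \<nu> where "\<nu> = centered_spherical_on m (vplane \<nn>)"
  have mu: "uniform_measure_dim m \<mu>" and m: "0 < m" and n: "norm \<nn> = 1"
    using assms by (auto simp: m_def)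
  note mu' = uniform_measure_dimD[OF mu]
  obtain R where radon: "radon_measure \<nu>" and R: "\<And>i. 0 < R i" "filterlim R at_top sequentially"
    and lim: "vague_limit (\<lambda>i. scale_measure (ennreal (1 / R i ^ m)) (rescale \<mu> (R i))) \<nu>"
    using assms(3) by (auto simp: Tan_infinity_def m_def \<nu>_def)
  have "emeasure \<nu> (kball 0 r) = ennreal (r ^ m)" if "0 < r" for r
  proof (rule vague_limit_kball[OF lim sets_blowdown _ _ _ that])
    show "emeasure (scale_measure (ennreal (1 / R i ^ m)) (rescale \<mu> (R i))) (kball 0 s) = ennreal (s ^ m)"
      if "0 < s" for i s
      using blowdown_kball[OF mu mu'(3) R(1) that, of i] by (simp add: dilation_def zero_prod_def)
  qed (use radon in \<open>auto simp: radon_measure_def\<close>)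
  note nu = flat_measure_uniform[OF radon[unfolded \<nu>_def] this[unfolded \<nu>_def], folded \<nu>_def]
  obtain c where c: "\<And>x. x \<in> msupport \<mu> \<Longrightarrow> \<nn> \<bullet> fst x = 0 \<or> \<nn> \<bullet> fst x = c"
    using blowdown_flat_support[OF mu m n R lim nu] by blast
  have "\<mu> = \<nu>" by (rule uniform_measure_eq_flat[OF mu nu(1,2) c])
  then show ?thesis by (simp add: \<nu>_def m_def)
qed

end
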